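(* Let $(u^{(i)},u^{\mathrm{ref}},v^{(i)},\hat q^{(i)})_{i=1,\dots,N}$ be the solution of the closed-loop system described in the context. Then for every $i\in\{1,\dots,N\}$, every $\sigma\in(0,\lambda)$ and every $t>0$, $$\left|q^{(i)}(t)-\hat q^{(i)}(0,t)\right|\le \left\|u^{(i)}(\cdot,t)-v^{(i)}(\cdot,t)-\hat q^{(i)}(\cdot,t)\right\|_{C([0,1])}\le e^{-\sigma t}\left\|u_0^{(i)}-v_0^{(i)}-\hat q_0^{(i)}\right\|_{C([0,1])}+\frac{1}{\lambda-\sigma}\left\|f^{(i)}\right\|_{C(\overline{Q}_t)}.$$
   Context: Notation: $\mathbb{R}_{\ge0}=[0,\infty)$, $\mathbb{R}_{>0}=(0,\infty)$, $Q_\infty=(0,1)\times\mathbb{R}_{>0}$, $\overline Q_\infty=[0,1]\times\mathbb{R}_{\ge0}$, $\overline Q_t=[0,1]\times[0,t]$. $\|h\|_{C(K)}=\max_{K}|h|$ for continuous $h$ on a compact set $K$. Subscripts $t,x$ denote partial derivatives. $N\ge2$ is an integer; $i$ ranges over $\{1,\dots,N\}$; the agent index $0$ is read as $N$ (so $u^{(0)}=u^{(N)}$). Constants: $\alpha>0$, $\lambda>0$, $l>0$, and gains $k_i\in(0,l)$. Closed-loop system, for $(x,t)\in Q_\infty$ (boundary conditions for $t>0$, initial conditions for $x\in(0,1)$): Agents: $u^{(i)}_t=\alpha u^{(i)}_{xx}-\lambda u^{(i)}+f^{(i)}$, $u^{(i)}(0,t)=q^{(i)}(t)+U^{(i)}_0(t)$,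 $u^{(i)}_x(1,t)=-l\,u^{(i)}(1,t)+U^{(i)}_1(t)$, $u^{(i)}(x,0)=u^{(i)}_0(x)$. Reference: $u^{\mathrm{ref}}_t=\alpha u^{\mathrm{ref}}_{xx}-\lambda u^{\mathrm{ref}}$, $u^{\mathrm{ref}}(0,t)=r(t)$, $u^{\mathrm{ref}}_x(1,t)=-l\,u^{\mathrm{ref}}(1,t)$, $u^{\mathrm{ref}}(x,0)=u^{\mathrm{ref}}_0(x)$. Auxiliary system: $v^{(i)}_t=\alpha v^{(i)}_{xx}-\lambda v^{(i)}$, $v^{(i)}(0,t)=U^{(i)}_0(t)$, $v^{(i)}_x(1,t)=-l\,v^{(i)}(1,t)+U^{(i)}_1(t)$, $v^{(i)}(x,0)=v^{(i)}_0(x)$. Disturbance observer: $\hat q^{(i)}_t=\alpha\hat q^{(i)}_{xx}-\lambda\hat q^{(i)}$, $\hat q^{(i)}_x(0,t)=u^{(i)}_x(0,t)-v^{(i)}_x(0,t)$, $\hat q^{(i)}_x(1,t)=-l\,\hat q^{(i)}(1,t)$, $\hat q^{(i)}(x,0)=\hat q^{(i)}_0(x)$. Control laws: $U^{(i)}_0(t)=r(t)-\hat q^{(i)}(0,t)+d^{(i)}_0(t)$ and $U^{(i)}_1(t)=k_i\big(u^{(i-1)}(1,t)-u^{\mathrm{ref}}(1,t)\big)+d^{(i)}_1(t)$. Write $\widetilde u^{(i)}=u^{(i)}-u^{\mathrm{ref}}$ and $\widetilde u^{(i)}_0=u^{(i)}_0-u^{\mathrm{ref}}_0$. Standing assumptions: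 $f^{(i)}\in C(\overline Q_\infty)$; $d^{(i)}_0,d^{(i)}_1,q^{(i)},r\in C^1(\mathbb{R}_{\ge0})$; $\widetilde u^{(i)}_0,u^{\mathrm{ref}}_0,v^{(i)}_0\in H^2(0,1)\cap C([0,1])$; and the compatibility conditions $\widetilde u^{(i)}_0(0)=q^{(i)}(0)+d^{(i)}_0(0)-\hat q^{(i)}_0(0)$, $\widetilde u^{(i)}_{0x}(1)=-l\,\widetilde u^{(i)}_0(1)+k_i\widetilde u^{(i-1)}_0(1)+d^{(i)}_1(0)$, $u^{\mathrm{ref}}_0(0)=r(0)$, $u^{\mathrm{ref}}_{0x}(1)=-l\,u^{\mathrm{ref}}_0(1)$, $v^{(i)}_0(0)=U^{(i)}_0(0)$, $v^{(i)}_{0x}(1)=-l\,v^{(i)}_0(1)+U^{(i)}_1(0)$. The solution is a classical one, each component belonging to $C(\mathbb{R}_{\ge0};H^2(0,1))\cap C^1(\mathbb{R}_{\ge0};L^2(0,1))$. *)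

theory Defs
  imports "HOL-Analysis.Analysis"
begin

section \<open>Function spaces\<close>

abbreviation unit_lebesgue :: "real measure" where
  "unit_lebesgue \<equiv> lebesgue_on {0<..<1}"

definition L2 :: "(real \<Rightarrow> real) set" where
  "L2 = {h. h \<in> borel_measurable unit_lebesgue \<and> integrable unit_lebesgue (\<lambda>x. (h x)\<^sup>2)}"

definition L2_norm :: "(real \<Rightarrow> real) \<Rightarrow> real" where
  "L2_norm h = sqrt (LINT x|unit_lebesgue. (h x)\<^sup>2)"

text \<open>Sobolev spaces on the interval, with the test space of continuously differentiable functions
  compactly supported in the open interval (Brezis, Functional Analysis, Sobolev Spaces and PDEs,
  Section 8.2).\<close>

definition test_function :: "(real \<Rightarrow> real) \<Rightarrow> bool" where
  "test_function \<phi> \<longleftrightarrow>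
     (\<forall>x. \<phi> differentiable (at x)) \<and> continuous_on UNIV (deriv \<phi>) \<and>
     (\<exists>a b. 0 < a \<and> b < 1 \<and> (\<forall>x. x \<notin> {a..b} \<longrightarrow> \<phi> x = 0))"

definition is_weak_deriv :: "(real \<Rightarrow> real) \<Rightarrow> (real \<Rightarrow> real) \<Rightarrow> bool" where
  "is_weak_deriv h g \<longleftrightarrow>
     (\<forall>\<phi>. test_function \<phi> \<longrightarrow>
        (LINT x|unit_lebesgue. h x * deriv \<phi> x) = - (LINT x|unit_lebesgue. g x * \<phi> x))"

definition H1 :: "(real \<Rightarrow> real) set" where
  "H1 = {h \<in> L2. \<exists>g \<in> L2. is_weak_deriv h g}"

text \<open>A representative of the weak derivative; it is determined only up to null sets, so it must be
  used only inside integrals and almost-everywhere statements.\<close>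

definition wderiv :: "(real \<Rightarrow> real) \<Rightarrow> real \<Rightarrow> real" where
  "wderiv h = (SOME g. g \<in> L2 \<and> is_weak_deriv h g)"

definition H2 :: "(real \<Rightarrow> real) set" where
  "H2 = {h \<in> H1. wderiv h \<in> H1}"

definition H2_norm :: "(real \<Rightarrow> real) \<Rightarrow> real" where
  "H2_norm h = sqrt ((L2_norm h)\<^sup>2 + (L2_norm (wderiv h))\<^sup>2 + (L2_norm (wderiv (wderiv h)))\<^sup>2)"

text \<open>Functions of \<open>(x, t)\<close> are curried with the space variable first, \<open>u x t\<close>.\<close>

definition cont_time_L2 :: "(real \<Rightarrow> real \<Rightarrow> real) \<Rightarrow> bool" where
  "cont_time_L2 u \<longleftrightarrow>
     (\<forall>t\<ge>0. (\<lambda>x. u x t) \<in> L2 \<and>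
       ((\<lambda>s. L2_norm (\<lambda>x. u x s - u x t)) \<longlongrightarrow> 0) (at t within {0..}))"

definition cont_time_H2 :: "(real \<Rightarrow> real \<Rightarrow> real) \<Rightarrow> bool" where
  "cont_time_H2 u \<longleftrightarrow>
     (\<forall>t\<ge>0. (\<lambda>x. u x t) \<in> H2 \<and>
       ((\<lambda>s. H2_norm (\<lambda>x. u x s - u x t)) \<longlongrightarrow> 0) (at t within {0..}))"

text \<open>The curve \<open>t \<mapsto> u(\<sqdot>, t)\<close> is continuously differentiable from \<open>[0,\<infinity>)\<close> to \<open>L\<^sup>2(0,1)\<close>, with
  derivative \<open>t \<mapsto> ut(\<sqdot>, t)\<close>.\<close>

definition C1_time_L2 :: "(real \<Rightarrow> real \<Rightarrow> real) \<Rightarrow> (real \<Rightarrow> real \<Rightarrow> real) \<Rightarrow> bool" where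
  "C1_time_L2 u ut \<longleftrightarrow>
     cont_time_L2 u \<and> cont_time_L2 ut \<and>
     (\<forall>t\<ge>0. ((\<lambda>s. L2_norm (\<lambda>x. (u x s - u x t) / (s - t) - ut x t)) \<longlongrightarrow> 0) (at t within {0..}))"

definition C1_halfline :: "(real \<Rightarrow> real) \<Rightarrow> bool" where
  "C1_halfline g \<longleftrightarrow>
     (\<exists>g'. continuous_on {0..} g' \<and>
       (\<forall>t\<ge>0. (g has_real_derivative g' t) (at t within {0..})))"

text \<open>For continuous \<open>h\<close> on a nonempty compact \<open>K\<close> the supremum is the maximum.\<close>

definition C_norm :: "'a set \<Rightarrow> ('a \<Rightarrow> real) \<Rightarrow> real" where
  "C_norm K h = (SUP z\<in>K. \<bar>h z\<bar>)"

section \<open>The closed-loop system\<close>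

text \<open>Classical solution of \<open>u\<^sub>t = \<alpha> u\<^sub>x\<^sub>x - lam u + f\<close> on \<open>(0,1) \<times> (0,\<infinity>)\<close> in the class
  \<open>C([0,\<infinity>); H\<^sup>2(0,1)) \<inter> C\<^sup>1([0,\<infinity>); L\<^sup>2(0,1))\<close>: \<open>u\<^sub>t(\<sqdot>, t)\<close> and \<open>u\<^sub>x\<^sub>x(\<sqdot>, t)\<close> are elements of
  \<open>L\<^sup>2(0,1)\<close>, and the equation is an identity in that space for every \<open>t > 0\<close>. A solution in this class
  with pointwise partial derivatives is covered, since these agree almost everywhere with the ones
  used here. The continuity condition selects the continuous representative of \<open>u(\<sqdot>, t)\<close>, which
  is then continuously differentiable on \<open>[0,1]\<close>; boundary values refer to it.\<close>

definition classical_solution ::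
  "real \<Rightarrow> real \<Rightarrow> (real \<Rightarrow> real \<Rightarrow> real) \<Rightarrow> (real \<Rightarrow> real \<Rightarrow> real) \<Rightarrow> bool" where
  "classical_solution \<alpha> lam f u \<longleftrightarrow>
     cont_time_H2 u \<and> (\<forall>t\<ge>0. continuous_on {0..1} (\<lambda>x. u x t)) \<and>
     (\<exists>ut. C1_time_L2 u ut \<and>
       (\<forall>t>0. AE x in unit_lebesgue.
          ut x t = \<alpha> * wderiv (wderiv (\<lambda>y. u y t)) x - lam * u x t + f x t))"

text \<open>\<open>h\<^sub>x(x) = D\<close> for \<open>x\<close> in \<open>[0,1]\<close>, one-sided at the end points.\<close>

abbreviation x_deriv :: "(real \<Rightarrow> real) \<Rightarrow> real \<Rightarrow> real \<Rightarrow> bool" where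
  "x_deriv h x D \<equiv> (h has_real_derivative D) (at x within {0..1})"

text \<open>The agent preceding \<open>i\<close>, index 0 being read as \<open>N\<close>.\<close>

definition pred_agent :: "nat \<Rightarrow> nat \<Rightarrow> nat" where
  "pred_agent N i = (if i = 1 then N else i - 1)"

definition U0 :: "(real \<Rightarrow> real) \<Rightarrow> (nat \<Rightarrow> real \<Rightarrow> real \<Rightarrow> real) \<Rightarrow> (nat \<Rightarrow> real \<Rightarrow> real)
    \<Rightarrow> nat \<Rightarrow> real \<Rightarrow> real" where
  "U0 r qh d0 i t = r t - qh i 0 t + d0 i t"

definition U1 :: "nat \<Rightarrow> (nat \<Rightarrow> real) \<Rightarrow> (nat \<Rightarrow> real \<Rightarrow> real \<Rightarrow> real) \<Rightarrow> (real \<Rightarrow> real \<Rightarrow> real)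
    \<Rightarrow> (nat \<Rightarrow> real \<Rightarrow> real) \<Rightarrow> nat \<Rightarrow> real \<Rightarrow> real" where
  "U1 N k u uref d1 i t = k i * (u (pred_agent N i) 1 t - uref 1 t) + d1 i t"

definition agent_system where
  "agent_system \<alpha> lam l f q U\<^sub>0 U\<^sub>1 u\<^sub>0 u \<longleftrightarrow>
     classical_solution \<alpha> lam f u \<and>
     (\<forall>t>0. u 0 t = q t + U\<^sub>0 t) \<and>
     (\<forall>t>0. x_deriv (\<lambda>x. u x t) 1 (- l * u 1 t + U\<^sub>1 t)) \<and>
     (\<forall>x\<in>{0<..<1}. u x 0 = u\<^sub>0 x)"

definition reference_system where
  "reference_system \<alpha> lam l r uref\<^sub>0 uref \<longleftrightarrow>
     classical_solution \<alpha> lam (\<lambda>x t. 0) uref \<and>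
     (\<forall>t>0. uref 0 t = r t) \<and>
     (\<forall>t>0. x_deriv (\<lambda>x. uref x t) 1 (- l * uref 1 t)) \<and>
     (\<forall>x\<in>{0<..<1}. uref x 0 = uref\<^sub>0 x)"

definition auxiliary_system where
  "auxiliary_system \<alpha> lam l U\<^sub>0 U\<^sub>1 v\<^sub>0 v \<longleftrightarrow>
     classical_solution \<alpha> lam (\<lambda>x t. 0) v \<and>
     (\<forall>t>0. v 0 t = U\<^sub>0 t) \<and>
     (\<forall>t>0. x_deriv (\<lambda>x. v x t) 1 (- l * v 1 t + U\<^sub>1 t)) \<and>
     (\<forall>x\<in>{0<..<1}. v x 0 = v\<^sub>0 x)"

definition disturbance_observer where
  "disturbance_observer \<alpha> lam l u v qh\<^sub>0 qh \<longleftrightarrow>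
     classical_solution \<alpha> lam (\<lambda>x t. 0) qh \<and>
     (\<forall>t>0. \<exists>a b. x_deriv (\<lambda>x. u x t) 0 a \<and> x_deriv (\<lambda>x. v x t) 0 b \<and>
        x_deriv (\<lambda>x. qh x t) 0 (a - b)) \<and>
     (\<forall>t>0. x_deriv (\<lambda>x. qh x t) 1 (- l * qh 1 t)) \<and>
     (\<forall>x\<in>{0<..<1}. qh x 0 = qh\<^sub>0 x)"

end

theory Submission imports Defs begin

text \<open>The error \<open>w = u - v - qh\<close> decouples from the controls and the disturbance: it solves
  \<open>w\<^sub>t = \<alpha> w\<^sub>x\<^sub>x - lam w + f\<close> with \<open>w\<^sub>x = 0\<close> at \<open>x = 0\<close> and \<open>w\<^sub>x = - l w\<close> at \<open>x = 1\<close>, and its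
  trace at \<open>x = 0\<close> is \<open>q - qh\<close>. With \<open>A\<close> the sup norm of \<open>w\<close> at time 0 and \<open>B\<close> that of \<open>f\<close>, the
  function \<open>m(t) = exp (- lam t) A + B / lam\<close> is a supersolution, and \<open>\<bar>w\<bar> \<le> m\<close> follows by Stampacchia's
  truncation method: for a convex \<open>G\<close> vanishing exactly on the nonpositive numbers, the energy
  \<open>\<integral> G(\<plusminus>w - m) dx\<close> is zero at time 0 and nonincreasing. The solution class makes the energy
  differentiable in time; integration by parts in space needs that a continuous function in
  \<open>H\<^sup>2(0,1)\<close> is \<open>C\<^sup>1\<close> up to the boundary, which rests on the lemma of du Bois-Reymond.\<close>

section \<open>Lebesgue and gauge integrals on the unit interval; integration by parts for
  primitives of integrable functions\<close>

section \<open>Integration on the unit interval\<close>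

lemma finite_measure_unit: "finite_measure unit_lebesgue"
  by (rule finite_measure_lebesgue_on) simp

lemma measure_unit [simp]: "measure unit_lebesgue {0<..<1} = 1"
  by (simp add: measure_restrict_space)

lemma unit_integrable_bounded:
  fixes p :: "real \<Rightarrow> real"
  assumes "p \<in> borel_measurable unit_lebesgue" "\<And>x. x \<in> {0<..<1} \<Longrightarrow> \<bar>p x\<bar> \<le> B"
  shows "integrable unit_lebesgue p"
proof -
  interpret finite_measure unit_lebesgue by (rule finite_measure_unit)
  show ?thesis
    using assms by (intro integrable_const_bound[where B=B]) auto
qed

lemma unit_borel_continuous:
  fixes p :: "real \<Rightarrow> real"
  assumes "continuous_on {0..1} p"
  shows "p \<in> borel_measurable unit_lebesgue"
  by (rule continuous_imp_measurable_on_sets_lebesgue)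
     (use assms in \<open>auto intro: continuous_on_subset\<close>)

lemma continuous_unit_bound:
  fixes p :: "real \<Rightarrow> real"
  assumes "continuous_on {0..1} p"
  obtains B where "\<And>x. x \<in> {0..1} \<Longrightarrow> \<bar>p x\<bar> \<le> B"
  using compact_imp_bounded[OF compact_continuous_image[OF assms compact_Icc]]
  by (auto simp: bounded_iff simp del: atLeastAtMost_iff)

lemma unit_integrable_mult_continuous:
  fixes p :: "real \<Rightarrow> real"
  assumes "continuous_on {0..1} p" "integrable unit_lebesgue g"
  shows "integrable unit_lebesgue (\<lambda>x. g x * p x)"
proof -
  obtain B where B: "\<And>x. x \<in> {0..1} \<Longrightarrow> \<bar>p x\<bar> \<le> B"
    using continuous_unit_bound[OF assms(1)] by blast
  have [measurable]: "p \<in> borel_measurable unit_lebesgue"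
    by (rule unit_borel_continuous[OF assms(1)])
  have [measurable]: "g \<in> borel_measurable unit_lebesgue"
    using assms(2) by auto
  show ?thesis
  proof (rule Bochner_Integration.integrable_bound[where f="\<lambda>x. B * g x"])
    show "AE x in unit_lebesgue. norm (g x * p x) \<le> norm (B * g x)"
    proof (rule AE_I2)
      fix x :: real assume "x \<in> space unit_lebesgue"
      then have "\<bar>p x\<bar> \<le> \<bar>B\<bar>" using B[of x] by simp
      then have "\<bar>p x\<bar> * \<bar>g x\<bar> \<le> \<bar>B\<bar> * \<bar>g x\<bar>" by (rule mult_right_mono) simp
      then show "norm (g x * p x) \<le> norm (B * g x)" by (simp add: abs_mult mult.commute)
    qed
  qed (use assms in auto)
qed

lemma unit_integrable_continuous:
  fixes p :: "real \<Rightarrow> real"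
  assumes "continuous_on {0..1} p"
  shows "integrable unit_lebesgue p"
proof -
  obtain B where "\<And>x. x \<in> {0..1} \<Longrightarrow> \<bar>p x\<bar> \<le> B"
    using continuous_unit_bound[OF assms] by blast
  then show ?thesis
    using unit_integrable_bounded[OF unit_borel_continuous[OF assms], of B] by simp
qed

lemma unit_integrable_on:
  fixes g :: "real \<Rightarrow> real"
  assumes "integrable unit_lebesgue g"
  shows "g integrable_on {0..1}"
  using has_integral_integral_lebesgue_on[OF assms]
  by (simp add: integrable_on_open_interval_real[symmetric]
        has_integral_integrable[of g "integral\<^sup>L unit_lebesgue g"])

lemma unit_borel_ident [measurable]: "(\<lambda>x. x) \<in> borel_measurable unit_lebesgue"
  by (intro unit_borel_continuous continuous_intros)

text \<open>A bridge between Lebesgue integrals with a cut-off factor and gauge integrals over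
  initial segments. Strict and weak cut-offs both occur, because swapping the order of integration
  over the triangle \<open>y < x\<close> leads to its complement \<open>x \<le> y\<close>.\<close>

lemma unit_LINT_initial:
  fixes g :: "real \<Rightarrow> real"
  assumes "integrable unit_lebesgue g" "x \<in> {0..1}"
  shows "(LINT y|unit_lebesgue. g y * (if y < x then 1 else 0)) = integral {0..x} g" (is ?A)
    and "(LINT y|unit_lebesgue. g y * (if y \<le> x then 1 else 0)) = integral {0..x} g" (is ?B)
proof -
  have [measurable]: "g \<in> borel_measurable unit_lebesgue"
    using assms(1) by auto
  have i: "integrable unit_lebesgue (\<lambda>y. g y * (if P y then 1 else 0))"
    if [measurable]: "Measurable.pred unit_lebesgue P" for P
    by (rule Bochner_Integration.integrable_bound[OF assms(1)]) auto
  have i1: "integrable unit_lebesgue (\<lambda>y. g y * (if y < x then 1 else 0))"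
    and i2: "integrable unit_lebesgue (\<lambda>y. g y * (if y \<le> x then 1 else 0))"
    by (rule i; measurable)+
  have "(LINT y|unit_lebesgue. g y * (if y < x then 1 else 0))
      = integral {0<..<1} (\<lambda>y. if y \<in> {..<x} then g y else 0)"
    using lebesgue_integral_eq_integral[OF i1] by (simp add: if_distrib cong: if_cong)
  also have "\<dots> = integral ({0<..<1} \<inter> {..<x}) g"
    by (subst integral_restrict_Int) (simp only: Int_commute)
  also have "{0<..<1} \<inter> {..<x} = {0<..<x}"
    using assms(2) by auto
  finally show ?A by (simp add: integral_open_interval_real)
  have "(LINT y|unit_lebesgue. g y * (if y \<le> x then 1 else 0))
      = integral {0<..<1} (\<lambda>y. g y * (if y \<le> x then 1 else 0))"
    using lebesgue_integral_eq_integral[OF i2] by simp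
  also have "\<dots> = integral {0<..<1} (\<lambda>y. g y * (if y < x then 1 else 0))"
    by (rule integral_spike[where S="{x}"]) auto
  also have "\<dots> = (LINT y|unit_lebesgue. g y * (if y < x then 1 else 0))"
    using lebesgue_integral_eq_integral[OF i1] by simp
  finally show ?B using \<open>?A\<close> by simp
qed

lemma unit_LINT:
  fixes g :: "real \<Rightarrow> real"
  assumes "integrable unit_lebesgue g"
  shows "(LINT y|unit_lebesgue. g y) = integral {0..1} g"
  using lebesgue_integral_eq_integral[OF assms] by (simp add: integral_open_interval_real)

lemma unit_primitive_continuous:
  fixes g :: "real \<Rightarrow> real"
  assumes "integrable unit_lebesgue g"
  shows "continuous_on {0..1} (\<lambda>x. integral {0..x} g)"
  by (rule indefinite_integral_continuous_1[OF unit_integrable_on[OF assms]])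

text \<open>Fubini for \<open>g x * p y\<close> on the triangle \<open>y < x\<close>. Mere
  integrability of both densities suffices, which fits second derivatives that exist only
  weakly.\<close>

lemma unit_integral_by_parts:
  fixes g p :: "real \<Rightarrow> real"
  assumes g: "integrable unit_lebesgue g" and p: "integrable unit_lebesgue p"
  shows "(LINT x|unit_lebesgue. g x * integral {0..x} p) =
    integral {0..1} g * integral {0..1} p - (LINT x|unit_lebesgue. p x * integral {0..x} g)"
proof -
  let ?M = unit_lebesgue
  interpret finite_measure ?M by (rule finite_measure_unit)
  interpret pair_sigma_finite ?M ?M ..
  have [measurable]: "g \<in> borel_measurable ?M" "p \<in> borel_measurable ?M"
    using g p by auto
  have [measurable]: "fst \<in> borel_measurable (?M \<Otimes>\<^sub>M ?M)" "snd \<in> borel_measurable (?M \<Otimes>\<^sub>M ?M)"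
    using measurable_compose[OF measurable_fst unit_borel_ident, of ?M]
      measurable_compose[OF measurable_snd unit_borel_ident, of ?M] by simp_all
  let ?F = "\<lambda>x y. g x * p y * (if y < x then 1 else 0)"
  have i0: "integrable (?M \<Otimes>\<^sub>M ?M) (\<lambda>z. g (fst z) * p (snd z))"
    by (rule Fubini_integrable) (use g p in \<open>auto simp: abs_mult\<close>)
  have i1: "integrable (?M \<Otimes>\<^sub>M ?M) (case_prod ?F)"
    by (rule Bochner_Integration.integrable_bound[OF i0]) (auto simp: split_def)
  have inner: "(\<integral>y. ?F x y \<partial>?M) = g x * integral {0..x} p" if "x \<in> {0<..<1}" for x
  proof -
    have "(\<integral>y. ?F x y \<partial>?M) = g x * (\<integral>y. p y * (if y < x then 1 else 0) \<partial>?M)"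
      by (subst integral_mult_right_zero[symmetric]) (simp only: mult.assoc)
    then show ?thesis using unit_LINT_initial(1)[OF p, of x] that by simp
  qed
  have outer: "(\<integral>x. ?F x y \<partial>?M) = p y * integral {0..1} g - p y * integral {0..y} g"
    if "y \<in> {0<..<1}" for y
  proof -
    have i: "integrable ?M (\<lambda>x. g x * (if x \<le> y then 1 else 0))"
      by (rule Bochner_Integration.integrable_bound[OF g]) auto
    \<comment> \<open>For fixed \<open>y\<close> the integral over \<open>x > y\<close> is the total
      integral minus the one over \<open>x \<le> y\<close>; this produces the boundary term and the
      minus sign.\<close>
    have "(\<integral>x. ?F x y \<partial>?M) = (\<integral>x. p y * (g x - g x * (if x \<le> y then 1 else 0)) \<partial>?M)"
      by (rule Bochner_Integration.integral_cong) auto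
    also have "\<dots> = p y * (integral {0..1} g - integral {0..y} g)"
      using unit_LINT_initial(2)[OF g, of y] that g i unit_LINT[OF g] by simp
    finally show ?thesis by (simp add: algebra_simps)
  qed
  have "(\<integral>x. g x * integral {0..x} p \<partial>?M) = (\<integral>x. (\<integral>y. ?F x y \<partial>?M) \<partial>?M)"
    by (rule Bochner_Integration.integral_cong) (use inner in auto)
  also have "\<dots> = (\<integral>y. (\<integral>x. ?F x y \<partial>?M) \<partial>?M)"
    using Fubini_integral[OF i1] by simp
  also have "\<dots> = (\<integral>y. p y * integral {0..1} g - p y * integral {0..y} g \<partial>?M)"
    by (rule Bochner_Integration.integral_cong) (use outer in auto)
  also have "\<dots> = (\<integral>y. p y * integral {0..1} g \<partial>?M) - (\<integral>y. p y * integral {0..y} g \<partial>?M)"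
    using unit_integrable_mult_continuous[OF unit_primitive_continuous[OF g] p] p
    by (intro Bochner_Integration.integral_diff) auto
  finally show ?thesis using unit_LINT[OF p] by simp
qed

section \<open>The lemma of du Bois-Reymond\<close>

section \<open>Sobolev functions on the unit interval\<close>

text \<open>Off a closed set the distance is positive, so the bump is eventually zero there.
  Nonemptiness excludes the default \<open>infdist x {} = 0\<close>, for which the limit would be 1
  everywhere.\<close>

lemma closed_bump_tendsto_indicator:
  fixes C :: "real set"
  assumes "closed C" "C \<noteq> {}"
  shows "(\<lambda>n. max 0 (1 - real n * infdist x C)) \<longlonglongrightarrow> indicator C x"
proof (cases "x \<in> C")
  case True
  then show ?thesis by simp
next
  case False
  then have pos: "infdist x C > 0"
    using False assms in_closed_iff_infdist_zero[of C x] infdist_nonneg[of x C] by (simp add: less_le)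
  obtain n0 :: nat where n0: "1 / infdist x C \<le> real n0"
    using real_arch_simple by blast
  have "max 0 (1 - real n * infdist x C) = 0" if "n \<ge> n0" for n
  proof -
    have "1 / infdist x C \<le> real n" using n0 that by linarith
    then show ?thesis using pos by (simp add: field_simps)
  qed
  then show ?thesis
    using False by (intro tendsto_eventually) (auto simp: eventually_sequentially)
qed

text \<open>Up to a null set, the region where \<open>k\<close> is positive is a countable union of
  compact sets. Indicators of these sets, damped near 0 and 1, are limits of admissible bumps, so
  \<open>k\<close> integrates to zero against them. As these integrands are nonnegative, they vanish
  almost everywhere.\<close>

lemma AE_nonpos_if_orthogonal_bumps:
  fixes k :: "real \<Rightarrow> real"
  assumes k: "integrable unit_lebesgue k"
    and orth: "\<And>(\<psi> :: real \<Rightarrow> real) a b. continuous_on UNIV \<psi> \<Longrightarrow> 0 < a \<Longrightarrow> b < 1 \<Longrightarrow> (\<And>x. x \<notin> {a..b} \<Longrightarrow> \<psi> x = 0)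
      \<Longrightarrow> (LINT x|unit_lebesgue. k x * \<psi> x) = 0"
  shows "AE x in unit_lebesgue. k x \<le> 0"
proof -
  let ?M = unit_lebesgue
  \<comment> \<open>The cut-off vanishes outside \<open>{\<delta>..1 - \<delta>}\<close>, so
    multiplying by it makes any continuous function an admissible bump.\<close>
  define cut where "cut \<delta> x = max 0 (min (x - \<delta>) (1 - \<delta> - x))" for \<delta> x :: real
  have [measurable]: "k \<in> borel_measurable ?M" using k by auto
  have cut_cont: "continuous_on S (cut \<delta>)" for S \<delta>
    unfolding cut_def by (intro continuous_intros)
  have cut_bounds: "0 \<le> cut \<delta> x" "\<delta> > 0 \<Longrightarrow> x \<le> 1 \<Longrightarrow> cut \<delta> x \<le> 1" for \<delta> x
    by (auto simp: cut_def)
  have zero: "(LINT x|?M. k x * (cut \<delta> x * indicator C x)) = 0" if "closed C" "\<delta> > 0" for C \<delta>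
  proof (cases "C = {}")
    case False
    let ?b = "\<lambda>n x. cut \<delta> x * max 0 (1 - real n * infdist x C)"
    have [measurable]: "?b n \<in> borel_measurable ?M" for n
      by (intro unit_borel_continuous continuous_intros cut_cont)
    have lim: "(\<lambda>n. ?b n x) \<longlonglongrightarrow> cut \<delta> x * indicator C x" for x
      by (intro tendsto_mult_left closed_bump_tendsto_indicator False that(1))
    have ind [measurable]: "(\<lambda>x. cut \<delta> x * indicator C x) \<in> borel_measurable ?M"
      by (rule borel_measurable_LIMSEQ_real[where u="?b"]) (use lim in auto)
    \<comment> \<open>The bumps take values between 0 and 1 on the interval, so
      \<open>\<bar>k x\<bar>\<close> dominates.\<close>
    have "(\<lambda>n. LINT x|?M. k x * ?b n x) \<longlonglongrightarrow> (LINT x|?M. k x * (cut \<delta> x * indicator C x))"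
    proof (rule integral_dominated_convergence[where w="\<lambda>x. \<bar>k x\<bar>"])
      show "AE x in ?M. norm (k x * ?b n x) \<le> \<bar>k x\<bar>" for n
      proof (rule AE_I2)
        fix x :: real assume "x \<in> space ?M"
        then have "0 \<le> cut \<delta> x" "cut \<delta> x \<le> 1" using that(2) by (auto simp: cut_def)
        moreover have "0 \<le> max 0 (1 - real n * infdist x C)" "max 0 (1 - real n * infdist x C) \<le> 1"
          by (auto simp: infdist_nonneg)
        ultimately have "0 \<le> ?b n x" "?b n x \<le> 1"
          by (auto intro: mult_le_one simp: infdist_nonneg)
        then have "\<bar>?b n x\<bar> \<le> 1" by linarith
        then show "norm (k x * ?b n x) \<le> \<bar>k x\<bar>"
          using mult_left_mono[of "\<bar>?b n x\<bar>" 1 "\<bar>k x\<bar>"] by (simp add: abs_mult)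
      qed
    qed (use k in \<open>auto intro!: tendsto_mult_left lim\<close>)
    moreover have "(LINT x|?M. k x * ?b n x) = 0" for n
      by (rule orth[of _ \<delta> "1 - \<delta>"]) (use that in \<open>auto simp: cut_def intro!: continuous_intros\<close>)
    ultimately show ?thesis by (simp add: LIMSEQ_const_iff)
  qed simp
  let ?S = "{x \<in> {0<..<1}. k x > 0}"
  have "?S \<in> sets lebesgue"
  proof -
    have "{x \<in> space ?M. k x > 0} \<in> sets ?M" by measurable
    then show ?thesis by (auto simp: sets_restrict_space_iff)
  qed
  then obtain C T where CT: "fsigma C" "T \<in> null_sets lebesgue" "C \<union> T = ?S"
    using lebesgue_set_almost_fsigma by metis
  obtain F :: "nat \<Rightarrow> real set" where "range F \<subseteq> Collect compact" and C_eq: "C = (\<Union>n. F n)"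
    using CT(1) unfolding fsigma_Union_compact by (elim exE conjE)
  then have F: "compact (F n)" for n by blast
  have F_null: "AE x in ?M. k x * (cut (1 / Suc m) x * indicator (F n) x) = 0" for m n
  proof (rule integral_nonneg_eq_0_iff_AE[THEN iffD1])
    have [measurable]: "cut (1 / Suc m) \<in> borel_measurable ?M"
      by (intro unit_borel_continuous cut_cont)
    have [measurable]: "(\<lambda>x. indicator (F n) x :: real) \<in> borel_measurable ?M"
    proof -
      have "F n \<in> sets borel" using F by (rule borel_compact)
      then have "(indicator (F n) :: real \<Rightarrow> real) \<in> borel_measurable borel" by simp
      then show ?thesis
        by (intro measurable_restrict_space1 measurable_completion) simp
    qed
    show "integrable ?M (\<lambda>x. k x * (cut (1 / Suc m) x * indicator (F n) x))"
    proof (rule Bochner_Integration.integrable_bound[OF k])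
      show "AE x in ?M. norm (k x * (cut (1 / Suc m) x * indicator (F n) x)) \<le> norm (k x)"
      proof (rule AE_I2)
        fix x :: real assume x: "x \<in> space ?M"
        then have "0 \<le> cut (1 / Suc m) x" "cut (1 / Suc m) x \<le> 1"
          using cut_bounds[of "1 / Suc m" x] by simp_all
        then have "\<bar>cut (1 / Suc m) x * indicator (F n) x\<bar> \<le> 1"
          by (simp add: indicator_def)
        then show "norm (k x * (cut (1 / Suc m) x * indicator (F n) x)) \<le> norm (k x)"
          using mult_left_mono[of "\<bar>cut (1 / Suc m) x * indicator (F n) x\<bar>" 1 "\<bar>k x\<bar>"]
          by (simp add: abs_mult)
      qed
    qed measurable
    have "F n \<subseteq> ?S" using CT(3) C_eq by blast
    then have "0 \<le> k x * (cut (1 / Suc m) x * indicator (F n) x)" for x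
    proof (cases "x \<in> F n")
      case True
      then have "0 \<le> k x" using \<open>F n \<subseteq> ?S\<close> by auto
      moreover have "0 \<le> cut (1 / Suc m) x" by (simp add: cut_def)
      ultimately show ?thesis using True by simp
    qed simp
    then show "AE x in ?M. 0 \<le> k x * (cut (1 / Suc m) x * indicator (F n) x)" by simp
    show "(LINT x|?M. k x * (cut (1 / Suc m) x * indicator (F n) x)) = 0"
      by (rule zero) (use F in \<open>auto intro: compact_imp_closed\<close>)
  qed
  have "AE x in ?M. x \<notin> T"
    using AE_not_in[OF CT(2)] by (auto simp: AE_restrict_space_iff elim: eventually_mono)
  moreover have "AE x in ?M. \<forall>m n. k x * (cut (1 / Suc m) x * indicator (F n) x) = 0"
    unfolding AE_all_countable using F_null by blast
  ultimately show ?thesis using AE_space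
  proof eventually_elim
    case (elim x)
    then have x: "0 < x" "x < 1" by auto
    show ?case
    proof (rule ccontr)
      assume pos: "\<not> k x \<le> 0"
      then have "x \<in> C \<union> T" unfolding CT(3) using x by simp
      then have "x \<in> C" using elim by blast
      then obtain n where n: "x \<in> F n" using C_eq by blast
      \<comment> \<open>With this \<open>m\<close> the point \<open>x\<close> is farther than
        \<open>1 / Suc m\<close> from both end points, so the cut-off is positive at
        \<open>x\<close>.\<close>
      obtain m where m: "1 / real (Suc m) < min x (1 - x)"
        using reals_Archimedean[of "min x (1 - x)"] x by (auto simp: inverse_eq_divide)
      then have "cut (1 / Suc m) x > 0" by (auto simp: cut_def)
      moreover have "k x * (cut (1 / Suc m) x * indicator (F n) x) = 0" using elim by blast
      ultimately show False using pos n by simp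
    qed
  qed
qed

lemma AE_zero_if_orthogonal_bumps:
  fixes k :: "real \<Rightarrow> real"
  assumes k: "integrable unit_lebesgue k"
    and orth: "\<And>(\<psi> :: real \<Rightarrow> real) a b. continuous_on UNIV \<psi> \<Longrightarrow> 0 < a \<Longrightarrow> b < 1 \<Longrightarrow> (\<And>x. x \<notin> {a..b} \<Longrightarrow> \<psi> x = 0)
      \<Longrightarrow> (LINT x|unit_lebesgue. k x * \<psi> x) = 0"
  shows "AE x in unit_lebesgue. k x = 0"
proof -
  have "AE x in unit_lebesgue. k x \<le> 0"
    by (rule AE_nonpos_if_orthogonal_bumps[OF k orth])
  moreover have "AE x in unit_lebesgue. - k x \<le> 0"
  proof (rule AE_nonpos_if_orthogonal_bumps)
    show "integrable unit_lebesgue (\<lambda>x. - k x)" using k by simp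
    show "(LINT x|unit_lebesgue. - k x * \<psi> x) = 0"
      if "continuous_on UNIV \<psi>" "0 < a" "b < 1" "\<And>x. x \<notin> {a..b} \<Longrightarrow> \<psi> x = 0" for \<psi> a b
      using orth[OF that] by simp
  qed
  ultimately show ?thesis by eventually_elim auto
qed

text \<open>Source of the test functions for the du Bois-Reymond argument. The primitive vanishes
  left of \<open>a\<close> because the bump does, and right of \<open>b\<close> because the total
  mass is zero.\<close>

lemma primitive_bump:
  fixes \<theta> :: "real \<Rightarrow> real"
  assumes cont: "continuous_on UNIV \<theta>" and supp: "0 < a" "b < 1" "\<And>x. x \<notin> {a..b} \<Longrightarrow> \<theta> x = 0"
  defines "\<phi> \<equiv> \<lambda>x. integral {0..x} \<theta>"
  shows "(\<phi> has_real_derivative \<theta> x) (at x)"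
    and "integral {0..1} \<theta> = 0 \<Longrightarrow> test_function \<phi>"
proof -
  have c: "continuous_on S \<theta>" for S
    using cont continuous_on_subset by blast
  have deriv: "(\<phi> has_real_derivative \<theta> x) (at x)" for x
  proof -
    \<comment> \<open>For negative \<open>y\<close> the interval \<open>{0..y}\<close> is empty and
      \<open>\<phi> y = 0\<close>. Moving the base point to \<open>- R\<close> leaves the primitive
      unchanged on \<open>{- R..R}\<close>, since the bump vanishes on the negative axis, and makes
      \<open>x\<close> an interior point.\<close>
    define R where "R = \<bar>x\<bar> + 1"
    have neg: "integral {- R..y} \<theta> = 0" if "y \<le> 0" for y
    proof -
      have "integral {- R..y} \<theta> = integral {- R..y} (\<lambda>x. 0)"
        by (rule Henstock_Kurzweil_Integration.integral_cong) (use supp that in auto)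
      then show ?thesis by simp
    qed
    have eq: "integral {- R..y} \<theta> = \<phi> y" if "y \<in> {- R..R}" for y
    proof (cases "y \<le> 0")
      case True
      have "\<phi> y = 0" using True by (cases "y = 0") (auto simp: \<phi>_def)
      then show ?thesis using neg[OF True] by simp
    next
      case False
      then have "integral {- R..0} \<theta> + integral {0..y} \<theta> = integral {- R..y} \<theta>"
        by (intro Henstock_Kurzweil_Integration.integral_combine integrable_continuous_interval c)
           (auto simp: R_def)
      then show ?thesis using neg[of 0] by (simp add: \<phi>_def)
    qed
    have "((\<lambda>y. integral {- R..y} \<theta>) has_real_derivative \<theta> x) (at x within {- R..R})"
      by (rule integral_has_real_derivative[OF c]) (auto simp: R_def)
    moreover have "at x within {- R..R} = at x"
      by (rule at_within_interior) (auto simp: R_def)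
    ultimately have "((\<lambda>y. integral {- R..y} \<theta>) has_real_derivative \<theta> x) (at x)" by simp
    moreover have "eventually (\<lambda>y. y \<in> {- R<..<R}) (nhds x)"
      by (rule eventually_nhds_in_open) (auto simp: R_def)
    ultimately show ?thesis
      using eq by (subst DERIV_cong_ev[OF refl _ refl, of _ "\<lambda>y. integral {- R..y} \<theta>"])
                  (auto elim!: eventually_mono)
  qed
  then show "(\<phi> has_real_derivative \<theta> x) (at x)" .
  show "test_function \<phi>" if zero: "integral {0..1} \<theta> = 0"
    unfolding test_function_def
  proof (intro conjI allI exI)
    show "\<phi> differentiable at x" for x
      using deriv real_differentiable_def by blast
    have "deriv \<phi> = \<theta>"
      using deriv DERIV_imp_deriv by blast
    then show "continuous_on UNIV (deriv \<phi>)" using cont by simp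
    show "x \<notin> {a..b} \<longrightarrow> \<phi> x = 0" for x
    proof
      assume x: "x \<notin> {a..b}"
      have null: "integral {c..d} \<theta> = 0" if "\<And>y. y \<in> {c..d} \<Longrightarrow> y \<noteq> x \<Longrightarrow> y \<notin> {a..b}" for c d
      proof -
        have "integral {c..d} \<theta> = integral {c..d} (\<lambda>x. 0)"
          by (rule Henstock_Kurzweil_Integration.integral_cong) (use supp x that in blast)
        then show ?thesis by simp
      qed
      consider "x < a" | "b < x" "x \<le> 1" | "1 < x" using x by fastforce
      then show "\<phi> x = 0"
      proof cases
        case 1
        then show ?thesis unfolding \<phi>_def by (intro null) auto
      next
        case 2
        show ?thesis
        proof (cases "0 \<le> x")
          case True
          have "integral {0..x} \<theta> + integral {x..1} \<theta> = integral {0..1} \<theta>"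
            using 2 True by (intro Henstock_Kurzweil_Integration.integral_combine integrable_continuous_interval c) auto
          moreover have "integral {x..1} \<theta> = 0" using 2 by (intro null) auto
          ultimately show ?thesis using zero by (simp add: \<phi>_def)
        qed (auto simp: \<phi>_def)
      next
        case 3
        have "integral {0..1} \<theta> + integral {1..x} \<theta> = integral {0..x} \<theta>"
          using 3 by (intro Henstock_Kurzweil_Integration.integral_combine integrable_continuous_interval c) auto
        moreover have "integral {1..x} \<theta> = 0" using 3 supp(2) by (intro null) auto
        ultimately show ?thesis using zero by (simp add: \<phi>_def)
      qed
    qed
  qed (use supp in auto)
qed

text \<open>The difference \<open>K\<close> of \<open>h\<close> and the primitive of
  \<open>g\<close> is orthogonal to every bump of mean zero. An arbitrary bump becomes one of mean
  zero after subtracting a multiple of a fixed bump \<open>\<rho>\<close>, so some constant shift of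
  \<open>K\<close> is orthogonal to all bumps.\<close>

lemma weak_deriv_imp_primitive:
  assumes wd: "is_weak_deriv h g"
    and h: "integrable unit_lebesgue h" and g: "integrable unit_lebesgue g"
  obtains c where "AE x in unit_lebesgue. h x = c + integral {0..x} g"
proof -
  let ?M = unit_lebesgue
  define K where "K x = h x - integral {0..x} g" for x
  have K: "integrable ?M K"
    unfolding K_def using h unit_integrable_continuous[OF unit_primitive_continuous[OF g]] by auto
  have orth: "(LINT x|?M. K x * \<theta> x) = 0"
    if cont: "continuous_on UNIV \<theta>" and supp: "0 < a" "b < 1" "\<And>x. x \<notin> {a..b} \<Longrightarrow> \<theta> x = 0"
      and zero: "integral {0..1} \<theta> = 0" for \<theta> a b
  proof -
    define \<phi> where "\<phi> x = integral {0..x} \<theta>" for x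
    have "test_function \<phi>"
      unfolding \<phi>_def[abs_def] by (rule primitive_bump(2)[OF cont supp zero])
    moreover have "deriv \<phi> = \<theta>"
      unfolding \<phi>_def[abs_def] using primitive_bump(1)[OF cont supp] DERIV_imp_deriv by blast
    ultimately have 1: "(LINT x|?M. h x * \<theta> x) = - (LINT x|?M. g x * \<phi> x)"
      using wd by (auto simp: is_weak_deriv_def)
    have c: "continuous_on {0..1} \<theta>" using cont continuous_on_subset by blast
    have \<theta>: "integrable ?M \<theta>" by (rule unit_integrable_continuous[OF c])
    \<comment> \<open>The boundary term contains the integral of \<open>\<theta>\<close> as a factor
      and drops out.\<close>
    have "(LINT x|?M. g x * \<phi> x) = - (LINT x|?M. \<theta> x * integral {0..x} g)"
      using unit_integral_by_parts[OF g \<theta>] zero by (simp add: \<phi>_def)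
    with 1 have "(LINT x|?M. h x * \<theta> x) = (LINT x|?M. \<theta> x * integral {0..x} g)" by simp
    moreover have "(LINT x|?M. K x * \<theta> x)
        = (LINT x|?M. h x * \<theta> x - \<theta> x * integral {0..x} g)"
      unfolding K_def by (simp add: algebra_simps)
    moreover have "\<dots> = (LINT x|?M. h x * \<theta> x) - (LINT x|?M. \<theta> x * integral {0..x} g)"
      by (intro Bochner_Integration.integral_diff unit_integrable_mult_continuous
            unit_primitive_continuous c h g \<theta>)
    ultimately show ?thesis by simp
  qed
  \<comment> \<open>A tent on \<open>{1/4..3/4}\<close>; any fixed continuous bump with nonzero
    integral would serve.\<close>
  define \<rho> where "\<rho> x = max 0 (min (x - 1/4) (3/4 - x))" for x :: real
  have \<rho>_cont: "continuous_on S \<rho>" for S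
    unfolding \<rho>_def by (intro continuous_intros)
  define J where "J = integral {0..1} \<rho>"
  have "J \<noteq> 0"
  proof
    assume "J = 0"
    then have "\<forall>x\<in>{0..1}. \<rho> x = 0"
      using integral_eq_0_iff[of 0 1 \<rho>] \<rho>_cont by (simp add: J_def \<rho>_def)
    then have "\<rho> (1/2) = 0" by auto
    then show False by (simp add: \<rho>_def)
  qed
  \<comment> \<open>The only possible value: testing \<open>K - c\<close> with \<open>\<rho>\<close>
    itself must give zero.\<close>
  define c where "c = (LINT x|?M. K x * \<rho> x) / J"
  have "AE x in ?M. K x - c = 0"
  proof (rule AE_zero_if_orthogonal_bumps)
    show "integrable ?M (\<lambda>x. K x - c)"
      by (intro Bochner_Integration.integrable_diff K finite_measure.integrable_const finite_measure_unit)
    fix \<psi> :: "real \<Rightarrow> real" and a b assume cont: "continuous_on UNIV \<psi>" and supp: "0 < a" "b < 1" "\<And>x. x \<notin> {a..b} \<Longrightarrow> \<psi> x = 0"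
    have c1: "continuous_on S \<psi>" for S using cont continuous_on_subset by blast
    define I where "I = integral {0..1} \<psi>"
    have i: "integrable ?M \<psi>" "integrable ?M \<rho>" "integrable ?M (\<lambda>x. K x * \<psi> x)" "integrable ?M (\<lambda>x. K x * \<rho> x)"
      by (intro unit_integrable_continuous unit_integrable_mult_continuous c1 \<rho>_cont K)+
    have "(LINT x|?M. K x * (\<psi> x - I / J * \<rho> x)) = 0"
    proof (rule orth[of _ "min a (1/4)" "max b (3/4)"])
      have "integral {0..1} (\<lambda>x. \<psi> x - I / J * \<rho> x) = integral {0..1} \<psi> - integral {0..1} (\<lambda>x. I / J * \<rho> x)"
        by (intro Henstock_Kurzweil_Integration.integral_diff integrable_continuous_interval
              continuous_intros c1 \<rho>_cont)
      then show "integral {0..1} (\<lambda>x. \<psi> x - I / J * \<rho> x) = 0"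
        using \<open>J \<noteq> 0\<close> by (simp add: I_def J_def)
      show "continuous_on UNIV (\<lambda>x. \<psi> x - I / J * \<rho> x)"
        by (intro continuous_intros c1 \<rho>_cont)
      show "\<psi> x - I / J * \<rho> x = 0" if "x \<notin> {min a (1/4)..max b (3/4)}" for x
      proof -
        have "x \<notin> {a..b}" "x < 1/4 \<or> 3/4 < x" using that by auto
        then show ?thesis using supp(3)[of x] by (auto simp: \<rho>_def)
      qed
    qed (use supp in auto)
    also have "(LINT x|?M. K x * (\<psi> x - I / J * \<rho> x)) = (LINT x|?M. K x * \<psi> x - I / J * (K x * \<rho> x))"
      by (simp add: algebra_simps)
    also have "\<dots> = (LINT x|?M. K x * \<psi> x) - I * c"
      using i \<open>J \<noteq> 0\<close> by (simp add: c_def)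
    finally have "(LINT x|?M. K x * \<psi> x) = I * c" by simp
    moreover have "(LINT x|?M. (K x - c) * \<psi> x) = (LINT x|?M. K x * \<psi> x) - c * (LINT x|?M. \<psi> x)"
      using i by (simp add: left_diff_distrib)
    ultimately show "(LINT x|?M. (K x - c) * \<psi> x) = 0"
      using unit_LINT[OF i(1)] by (simp add: I_def)
  qed
  then show thesis
    by (intro that[of c]) (auto simp: K_def elim!: eventually_mono)
qed

section \<open>Algebra of square-integrable functions\<close>

lemma L2_imp_integrable:
  assumes "h \<in> L2"
  shows "integrable unit_lebesgue h"
proof (rule Bochner_Integration.integrable_bound[where f="\<lambda>x. 1 + (h x)\<^sup>2"])
  show "integrable unit_lebesgue (\<lambda>x. 1 + (h x)\<^sup>2)"
    using assms unfolding L2_def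
    by (intro Bochner_Integration.integrable_add finite_measure.integrable_const finite_measure_unit) auto
  have "\<bar>y\<bar> \<le> 1 + y\<^sup>2" for y :: real
    using sum_squares_bound[of 1 "\<bar>y\<bar>"] by simp
  then show "AE x in unit_lebesgue. norm (h x) \<le> norm (1 + (h x)\<^sup>2)"
    by (intro AE_I2) (simp add: abs_of_nonneg)
qed (use assms in \<open>auto simp: L2_def\<close>)

lemma L2_integrable_square: "h \<in> L2 \<Longrightarrow> integrable unit_lebesgue (\<lambda>x. (h x)\<^sup>2)"
  by (simp add: L2_def)

lemma L2_continuous: "continuous_on {0..1} p \<Longrightarrow> p \<in> L2"
  by (auto simp: L2_def intro!: unit_borel_continuous unit_integrable_continuous continuous_intros)

lemma L2_mult:
  assumes "f \<in> L2" "g \<in> L2"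
  shows "integrable unit_lebesgue (\<lambda>x. f x * g x)"
proof (rule Bochner_Integration.integrable_bound[where f="\<lambda>x. (f x)\<^sup>2 + (g x)\<^sup>2"])
  have "\<bar>a * b\<bar> \<le> a\<^sup>2 + b\<^sup>2" for a b :: real
    using sum_squares_bound[of "\<bar>a\<bar>" "\<bar>b\<bar>"] abs_ge_zero[of "a * b"]
    unfolding abs_mult power2_abs by linarith
  then show "AE x in unit_lebesgue. norm (f x * g x) \<le> norm ((f x)\<^sup>2 + (g x)\<^sup>2)"
    by (intro AE_I2) simp
qed (use assms in \<open>auto simp: L2_def\<close>)

lemma L2_add:
  assumes "f \<in> L2" "g \<in> L2"
  shows "(\<lambda>x. f x + g x) \<in> L2"
proof -
  have "integrable unit_lebesgue (\<lambda>x. (f x)\<^sup>2 + (g x)\<^sup>2 + 2 * (f x * g x))"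
    by (intro Bochner_Integration.integrable_add integrable_mult_right L2_integrable_square L2_mult assms)
  then show ?thesis
    using assms by (auto simp add: L2_def power2_sum mult.assoc)
qed

lemma L2_cmult: "f \<in> L2 \<Longrightarrow> (\<lambda>x. c * f x) \<in> L2"
  by (auto simp: L2_def power_mult_distrib)

lemma L2_diff: "f \<in> L2 \<Longrightarrow> g \<in> L2 \<Longrightarrow> (\<lambda>x. f x - g x) \<in> L2"
  using L2_add[of f "\<lambda>x. -1 * g x"] L2_cmult[of g "-1"] by simp

lemma continuous_AE_zero_imp_zero:
  fixes p :: "real \<Rightarrow> real"
  assumes "continuous_on {0..1} p" "AE x in unit_lebesgue. p x = 0" "x \<in> {0..1}"
  shows "p x = 0"
proof -
  have c: "continuous_on {0..1} (\<lambda>x. (p x)\<^sup>2)"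
    using assms(1) by (intro continuous_intros)
  have "(LINT x|unit_lebesgue. (p x)\<^sup>2) = 0"
    using assms(2) by (intro integral_eq_zero_AE) (auto elim: eventually_mono)
  then have "integral {0..1} (\<lambda>x. (p x)\<^sup>2) = 0"
    using unit_LINT[OF unit_integrable_continuous[OF c]] by simp
  then show ?thesis
    using integral_eq_0_iff[of 0 1 "\<lambda>x. (p x)\<^sup>2"] c assms(3) by auto
qed

section \<open>Regularity up to the boundary of continuous functions in H^2(0,1)\<close>

lemma H1_wderiv:
  assumes "h \<in> H1"
  shows "wderiv h \<in> L2" "is_weak_deriv h (wderiv h)"
proof -
  have "\<exists>g. g \<in> L2 \<and> is_weak_deriv h g" using assms by (auto simp: H1_def)
  then have "wderiv h \<in> L2 \<and> is_weak_deriv h (wderiv h)"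
    unfolding wderiv_def by (rule someI_ex)
  then show "wderiv h \<in> L2" "is_weak_deriv h (wderiv h)" by auto
qed

text \<open>The second derivative \<open>g\<close> exists only in the weak sense: \<open>h'\<close> is absolutely continuous
  with density \<open>g\<close>.\<close>

definition second_primitive :: "(real \<Rightarrow> real) \<Rightarrow> (real \<Rightarrow> real) \<Rightarrow> (real \<Rightarrow> real) \<Rightarrow> bool" where
  "second_primitive h h' g \<longleftrightarrow> g \<in> L2 \<and>
     (\<forall>x\<in>{0..1}. x_deriv h x (h' x) \<and> h' x = h' 0 + integral {0..x} g)"

text \<open>Du Bois-Reymond is applied twice. First \<open>wderiv h\<close> has a continuous
  representative \<open>h'\<close>; then \<open>h\<close> is almost everywhere a primitive of it.
  Continuity of \<open>h\<close> makes this an identity on the closed interval, and the fundamental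
  theorem of calculus applies.\<close>

lemma H2_second_primitive:
  assumes h: "h \<in> H2" and cont: "continuous_on {0..1} h"
  obtains h' where "second_primitive h h' (wderiv (wderiv h))"
proof -
  let ?M = unit_lebesgue
  define g1 where "g1 = wderiv h"
  define g2 where "g2 = wderiv g1"
  have "h \<in> H1" "g1 \<in> H1" using h by (auto simp: H2_def g1_def)
  then have L2: "h \<in> L2" "g1 \<in> L2" "g2 \<in> L2" and wd: "is_weak_deriv h g1" "is_weak_deriv g1 g2"
    using H1_wderiv unfolding g1_def g2_def by (auto simp: H1_def)
  note i = L2[THEN L2_imp_integrable]
  obtain c2 where c2: "AE x in ?M. g1 x = c2 + integral {0..x} g2"
    using weak_deriv_imp_primitive[OF wd(2) i(2,3)] by blast
  obtain c1 where c1: "AE x in ?M. h x = c1 + integral {0..x} g1"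
    using weak_deriv_imp_primitive[OF wd(1) i(1,2)] by blast
  define h' where "h' x = c2 + integral {0..x} g2" for x
  have h'_cont: "continuous_on {0..1} h'"
    unfolding h'_def by (intro continuous_intros unit_primitive_continuous i)
  \<comment> \<open>\<open>wderiv h\<close> is fixed only up to null sets, so the two primitives are
    compared through Lebesgue integrals.\<close>
  have prim_eq: "integral {0..x} g1 = integral {0..x} h'" if "x \<in> {0..1}" for x
  proof -
    have "(LINT y|?M. g1 y * (if y < x then 1 else 0)) = (LINT y|?M. h' y * (if y < x then 1 else 0))"
    proof (rule integral_cong_AE)
      have [measurable]: "g1 \<in> borel_measurable ?M" "h' \<in> borel_measurable ?M"
        using L2(2) unit_borel_continuous[OF h'_cont] by (auto simp: L2_def)
      show "(\<lambda>y. g1 y * (if y < x then 1 else 0)) \<in> borel_measurable ?M"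
        "(\<lambda>y. h' y * (if y < x then 1 else 0)) \<in> borel_measurable ?M" by measurable
      show "AE y in ?M. g1 y * (if y < x then 1 else 0) = h' y * (if y < x then 1 else 0)"
        using c2 by eventually_elim (simp add: h'_def)
    qed
    then show ?thesis
      using unit_LINT_initial(1)[OF i(2) that]
        unit_LINT_initial(1)[OF unit_integrable_continuous[OF h'_cont] that] by simp
  qed
  have "h x - (c1 + integral {0..x} h') = 0" if "x \<in> {0..1}" for x
  proof (rule continuous_AE_zero_imp_zero[OF _ _ that])
    show "continuous_on {0..1} (\<lambda>x. h x - (c1 + integral {0..x} h'))"
      by (intro continuous_intros cont unit_primitive_continuous unit_integrable_continuous h'_cont)
    show "AE x in ?M. h x - (c1 + integral {0..x} h') = 0"
      using c1 AE_space by eventually_elim (simp add: prim_eq)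
  qed
  then have h_eq: "h x = c1 + integral {0..x} h'" if "x \<in> {0..1}" for x
    using that by (metis eq_iff_diff_eq_0)
  have "x_deriv h x (h' x)" if "x \<in> {0..1}" for x
  proof -
    have "x_deriv (\<lambda>x. c1 + integral {0..x} h') x (h' x)"
      using integral_has_real_derivative[OF h'_cont that] by (auto intro!: derivative_eq_intros)
    then show ?thesis
      by (rule has_field_derivative_transform_within[where d=1]) (use that h_eq in auto)
  qed
  then have "second_primitive h h' g2"
    unfolding second_primitive_def using L2(3) by (auto simp: h'_def)
  then show thesis unfolding g1_def g2_def by (rule that)
qed

lemma second_primitiveD:
  assumes "second_primitive h h' g"
  shows "g \<in> L2" "x \<in> {0..1} \<Longrightarrow> x_deriv h x (h' x)"
    "x \<in> {0..1} \<Longrightarrow> h' x = h' 0 + integral {0..x} g"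
  using assms unfolding second_primitive_def by blast+

text \<open>Lets \<open>u - v - qh\<close> carry the combination of the three chosen second
  derivatives. The choice in \<open>wderiv\<close> then never has to be compared with the
  \<open>wderiv\<close> of a difference.\<close>

lemma second_primitive_linear:
  assumes f: "second_primitive f f' F" and g: "second_primitive g g' G"
  shows "second_primitive (\<lambda>x. a * f x + b * g x) (\<lambda>x. a * f' x + b * g' x) (\<lambda>x. a * F x + b * G x)"
  unfolding second_primitive_def
proof (intro conjI ballI)
  show "(\<lambda>x. a * F x + b * G x) \<in> L2"
    by (intro L2_add L2_cmult second_primitiveD(1)[OF f] second_primitiveD(1)[OF g])
  fix x :: real assume x: "x \<in> {0..1}"
  show "x_deriv (\<lambda>x. a * f x + b * g x) x (a * f' x + b * g' x)"
    by (intro DERIV_add DERIV_cmult second_primitiveD(2)[OF f x] second_primitiveD(2)[OF g x])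
  have int: "H integrable_on {0..x}" if "H \<in> L2" for H
    using unit_integrable_on[OF L2_imp_integrable[OF that]] x
    by (rule_tac integrable_on_subinterval) auto
  have "integral {0..x} (\<lambda>x. a * F x + b * G x)
      = integral {0..x} (\<lambda>x. a * F x) + integral {0..x} (\<lambda>x. b * G x)"
    by (intro Henstock_Kurzweil_Integration.integral_add int L2_cmult
          second_primitiveD(1)[OF f] second_primitiveD(1)[OF g])
  then show "a * f' x + b * g' x = a * f' 0 + b * g' 0 + integral {0..x} (\<lambda>x. a * F x + b * G x)"
    using second_primitiveD(3)[OF f x] second_primitiveD(3)[OF g x] by (simp add: algebra_simps)
qed

lemma second_primitive_continuous:
  assumes "second_primitive h h' g"
  shows "continuous_on {0..1} h" "continuous_on {0..1} h'"
proof -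
  show "continuous_on {0..1} h"
    using assms unfolding second_primitive_def
    by (intro DERIV_continuous_on) blast
  have "continuous_on {0..1} (\<lambda>x. h' 0 + integral {0..x} g)"
    by (intro continuous_on_add continuous_on_const unit_primitive_continuous L2_imp_integrable
          second_primitiveD(1)[OF assms])
  then show "continuous_on {0..1} h'"
    by (rule continuous_on_eq) (rule second_primitiveD(3)[OF assms, symmetric])
qed

section \<open>A smooth convex truncation function\<close>

section \<open>The maximum principle\<close>

text \<open>At the junction \<open>z = 0\<close> both one-sided derivatives are zero, because
  \<open>F\<close> and \<open>F'\<close> vanish there. It is used once for \<open>bend\<close> and
  once for \<open>bend'\<close>.\<close>

lemma DERIV_compose_max_zero:
  fixes F F' :: "real \<Rightarrow> real"
  assumes deriv: "\<And>z. (F has_real_derivative F' z) (at z)" and zero: "F 0 = 0" "F' 0 = 0"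
  shows "((\<lambda>z. F (max 0 z)) has_real_derivative F' (max 0 z)) (at z)"
proof -
  consider "z < 0" | "z = 0" | "z > 0" by linarith
  then show ?thesis
  proof cases
    case 1
    have "((\<lambda>z. 0) has_real_derivative 0) (at z)" by simp
    then have "((\<lambda>z. F (max 0 z)) has_real_derivative 0) (at z)"
      by (rule has_field_derivative_transform_within_open[where S="{..<0}"]) (use 1 zero in auto)
    then show ?thesis using 1 zero by simp
  next
    case 2
    have "(\<lambda>h. F h / h) \<midarrow>0\<rightarrow> 0"
      using deriv[of 0] zero by (simp add: DERIV_def)
    then have "(\<lambda>h. F (max 0 h) / h) \<midarrow>0\<rightarrow> 0"
      by (rule tendsto_0_le[where K=1]) (auto simp: max_def zero divide_le_0_iff intro!: always_eventually)
    then show ?thesis using 2 zero by (simp add: DERIV_def)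
  next
    case 3
    from deriv[of z] have "((\<lambda>z. F (max 0 z)) has_real_derivative F' z) (at z)"
      by (rule has_field_derivative_transform_within_open[where S="{0<..}"]) (use 3 in auto)
    then show ?thesis using 3 by simp
  qed
qed

text \<open>A smooth substitute for \<open>(max 0 z)\<^sup>2 / 2\<close>: \<open>bend\<close> is convex with bounded second derivative
  and vanishes exactly on \<open>z \<le> 0\<close>, but its derivative \<open>bend'\<close> is still \<open>C\<^sup>1\<close>, so that
  \<open>bend' (z x)\<close> has a continuous \<open>x\<close>-derivative.\<close>

definition bend :: "real \<Rightarrow> real" where "bend z = max 0 z - arctan (max 0 z)"
definition bend' :: "real \<Rightarrow> real" where "bend' z = (max 0 z)\<^sup>2 / (1 + (max 0 z)\<^sup>2)"
definition bend'' :: "real \<Rightarrow> real" where "bend'' z = 2 * max 0 z / (1 + (max 0 z)\<^sup>2)\<^sup>2"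

lemma one_plus_square_nonzero [simp]: "1 + (z::real)\<^sup>2 \<noteq> 0"
  using zero_le_power2[of z] by linarith

lemma DERIV_bend: "(bend has_real_derivative bend' z) (at z)"
proof -
  have "((\<lambda>z. z - arctan z) has_real_derivative z\<^sup>2 / (1 + z\<^sup>2)) (at z)" for z :: real
    by (auto intro!: derivative_eq_intros simp: field_simps)
  then show ?thesis
    unfolding bend_def[abs_def] bend'_def by (rule DERIV_compose_max_zero) auto
qed

lemma DERIV_bend': "(bend' has_real_derivative bend'' z) (at z)"
proof -
  have "((\<lambda>z. z\<^sup>2 / (1 + z\<^sup>2)) has_real_derivative 2 * z / (1 + z\<^sup>2)\<^sup>2) (at z)" for z :: real
    using one_plus_square_nonzero[of z]
    by (auto intro!: derivative_eq_intros simp: field_simps power2_eq_square)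
  then show ?thesis
    unfolding bend'_def[abs_def] bend''_def by (rule DERIV_compose_max_zero) auto
qed

lemma bend_continuous: "continuous_on S bend" "continuous_on S bend'" "continuous_on S bend''"
proof -
  show "continuous_on S bend"
    by (rule DERIV_continuous_on[OF has_field_derivative_at_within[OF DERIV_bend]])
  show "continuous_on S bend'"
    by (rule DERIV_continuous_on[OF has_field_derivative_at_within[OF DERIV_bend']])
  show "continuous_on S bend''"
    unfolding bend''_def[abs_def] by (intro continuous_intros) simp
qed

lemma bend'_bounds: "0 \<le> bend' z" "bend' z \<le> 1"
  using add_pos_nonneg[OF zero_less_one zero_le_power2[of "max 0 z"]]
  by (simp_all add: bend'_def)

lemma bend'_nonpos: "z \<le> 0 \<Longrightarrow> bend' z = 0"
  by (simp add: bend'_def)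

lemma bend''_bounds: "0 \<le> bend'' z" "bend'' z \<le> 1"
proof -
  define p where "p = max 0 z"
  have "p \<ge> 0" by (simp add: p_def)
  then show "0 \<le> bend'' z" by (simp add: bend''_def p_def)
  have "2 * p \<le> 1 + p\<^sup>2" using sum_squares_bound[of 1 p] by simp
  also have "\<dots> \<le> (1 + p\<^sup>2)\<^sup>2" by (rule self_le_power) auto
  finally show "bend'' z \<le> 1"
    using zero_le_power2[of p] by (simp add: bend''_def p_def[symmetric])
qed

lemma bend_nonpos: "z \<le> 0 \<Longrightarrow> bend z = 0"
  by (simp add: bend_def)

lemma bend_pos:
  assumes "z > 0"
  shows "bend z > 0"
proof -
  obtain y where y: "0 < y" "y < z" "bend z - bend 0 = (z - 0) * bend' y"
    using MVT2[OF assms DERIV_bend] by blast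
  then show ?thesis
    using assms by (simp add: bend_nonpos bend'_def add_pos_nonneg)
qed

lemma bend_nonneg: "bend z \<ge> 0"
  using bend_pos[of z] bend_nonpos[of z] by linarith

text \<open>As \<open>bend''\<close> is at most 1, \<open>bend'\<close> is 1-Lipschitz. Subtracting
  the tangent slope at \<open>a\<close> from \<open>bend\<close> leaves a function whose derivative
  on the segment is at most \<open>\<bar>b - a\<bar>\<close>. The sharper factor 1/2 is not
  pursued.\<close>

lemma bend_taylor: "\<bar>bend b - bend a - bend' a * (b - a)\<bar> \<le> (b - a)\<^sup>2"
proof -
  have lip: "\<bar>bend' y - bend' x\<bar> \<le> \<bar>y - x\<bar>" for x y
  proof -
    have "norm (bend' y - bend' x) \<le> 1 * norm (y - x)"
      by (rule field_differentiable_bound[of UNIV bend' bend''])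
         (use DERIV_bend' bend''_bounds in simp_all)
    then show ?thesis by simp
  qed
  have "bend b - bend a - bend' a * (b - a) = (\<lambda>y. bend y - bend' a * y) b - (\<lambda>y. bend y - bend' a * y) a"
    by (simp add: algebra_simps)
  also have "\<bar>\<dots>\<bar> \<le> \<bar>b - a\<bar> * \<bar>b - a\<bar>"
    unfolding real_norm_def[symmetric]
  proof (rule field_differentiable_bound)
    show "convex (closed_segment a b)" by simp
    show "((\<lambda>y. bend y - bend' a * y) has_field_derivative bend' y - bend' a) (at y within closed_segment a b)" for y
      using DERIV_diff[OF DERIV_bend DERIV_cmult_Id] by (rule has_field_derivative_at_within)
    show "norm (bend' y - bend' a) \<le> norm (b - a)" if "y \<in> closed_segment a b" for y
      using lip[of y a] that by (auto simp: closed_segment_eq_real_ivl split: if_splits)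
  qed auto
  finally show ?thesis by (simp add: power2_eq_square abs_mult_self_eq)
qed

section \<open>Time derivatives in L^2(0,1) and the derivative of the energy\<close>

definition L2_time_deriv :: "(real \<Rightarrow> real \<Rightarrow> real) \<Rightarrow> (real \<Rightarrow> real) \<Rightarrow> real \<Rightarrow> bool" where
  "L2_time_deriv u ut t \<longleftrightarrow> (\<forall>s\<ge>0. (\<lambda>x. u x s) \<in> L2) \<and> ut \<in> L2 \<and>
     ((\<lambda>s. LINT x|unit_lebesgue. ((u x s - u x t) / (s - t) - ut x)\<^sup>2) \<longlongrightarrow> 0) (at t within {0..})"

lemma L2_remainder:
  assumes "f \<in> L2" "g \<in> L2" "h \<in> L2"
  shows "(\<lambda>x. (f x - g x) / c - h x) \<in> L2"
  using L2_diff[OF L2_cmult[OF L2_diff[OF assms(1,2)], of "1 / c"] assms(3)] by simp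

lemma C1_time_L2_imp_deriv:
  assumes "C1_time_L2 u ut" "t \<ge> 0"
  shows "L2_time_deriv u (\<lambda>x. ut x t) t"
proof -
  let ?R = "\<lambda>s x. (u x s - u x t) / (s - t) - ut x t"
  have "((\<lambda>s. L2_norm (?R s)) \<longlongrightarrow> 0) (at t within {0..})"
    using assms by (simp add: C1_time_L2_def)
  then have "((\<lambda>s. (L2_norm (?R s))\<^sup>2) \<longlongrightarrow> 0\<^sup>2) (at t within {0..})"
    by (rule tendsto_power)
  moreover have "(L2_norm (?R s))\<^sup>2 = (LINT x|unit_lebesgue. (?R s x)\<^sup>2)" for s
    by (simp add: L2_norm_def)
  ultimately show ?thesis
    using assms by (simp add: L2_time_deriv_def C1_time_L2_def cont_time_L2_def)
qed

text \<open>With the squared norm in the definition, \<open>(p + q)^2 \<le> 2 p^2 + 2 q^2\<close>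
  under the integral takes the place of the triangle inequality.\<close>

lemma L2_time_deriv_linear:
  assumes u: "L2_time_deriv u ut t" and v: "L2_time_deriv v vt t" and t: "t \<ge> 0"
  shows "L2_time_deriv (\<lambda>x s. a * u x s + b * v x s) (\<lambda>x. a * ut x + b * vt x) t"
proof -
  let ?M = unit_lebesgue
  let ?U = "\<lambda>s x. (u x s - u x t) / (s - t) - ut x"
  let ?V = "\<lambda>s x. (v x s - v x t) / (s - t) - vt x"
  let ?W = "\<lambda>s x. (a * u x s + b * v x s - (a * u x t + b * v x t)) / (s - t) - (a * ut x + b * vt x)"
  have L2: "\<And>s. s \<ge> 0 \<Longrightarrow> (\<lambda>x. u x s) \<in> L2" "ut \<in> L2" "\<And>s. s \<ge> 0 \<Longrightarrow> (\<lambda>x. v x s) \<in> L2" "vt \<in> L2"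
    using u v by (auto simp: L2_time_deriv_def)
  have W_eq: "?W s x = a * ?U s x + b * ?V s x" for s x
    by (simp add: diff_divide_distrib add_divide_distrib algebra_simps)
  have UL2: "?U s \<in> L2" and VL2: "?V s \<in> L2" if "s \<ge> 0" for s
    using that t by (auto intro!: L2_remainder L2)
  have W_le: "(LINT x|?M. (?W s x)\<^sup>2) \<le> 2 * a\<^sup>2 * (LINT x|?M. (?U s x)\<^sup>2) + 2 * b\<^sup>2 * (LINT x|?M. (?V s x)\<^sup>2)"
    if "s \<ge> 0" for s
  proof -
    have "(LINT x|?M. (?W s x)\<^sup>2) \<le> (LINT x|?M. 2 * a\<^sup>2 * (?U s x)\<^sup>2 + 2 * b\<^sup>2 * (?V s x)\<^sup>2)"
    proof (rule integral_mono)
      show "integrable ?M (\<lambda>x. (?W s x)\<^sup>2)"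
        unfolding W_eq by (intro L2_integrable_square L2_add L2_cmult UL2 VL2 that)
      show "integrable ?M (\<lambda>x. 2 * a\<^sup>2 * (?U s x)\<^sup>2 + 2 * b\<^sup>2 * (?V s x)\<^sup>2)"
        by (intro Bochner_Integration.integrable_add integrable_mult_right L2_integrable_square UL2 VL2 that)
      have "(p + q)\<^sup>2 \<le> 2 * p\<^sup>2 + 2 * q\<^sup>2" for p q :: real
        using sum_squares_bound[of p q] by (simp add: power2_sum)
      then show "(?W s x)\<^sup>2 \<le> 2 * a\<^sup>2 * (?U s x)\<^sup>2 + 2 * b\<^sup>2 * (?V s x)\<^sup>2" for x
        unfolding W_eq power_mult_distrib mult.assoc
        by (metis power_mult_distrib)
    qed
    also have "\<dots> = 2 * a\<^sup>2 * (LINT x|?M. (?U s x)\<^sup>2) + 2 * b\<^sup>2 * (LINT x|?M. (?V s x)\<^sup>2)"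
      using L2_integrable_square[OF UL2[OF that]] L2_integrable_square[OF VL2[OF that]] by simp
    finally show ?thesis .
  qed
  have "((\<lambda>s. 2 * a\<^sup>2 * (LINT x|?M. (?U s x)\<^sup>2) + 2 * b\<^sup>2 * (LINT x|?M. (?V s x)\<^sup>2))
      \<longlongrightarrow> 2 * a\<^sup>2 * 0 + 2 * b\<^sup>2 * 0) (at t within {0..})"
    using u v unfolding L2_time_deriv_def by (intro tendsto_intros) auto
  then have lim: "((\<lambda>s. 2 * a\<^sup>2 * (LINT x|?M. (?U s x)\<^sup>2) + 2 * b\<^sup>2 * (LINT x|?M. (?V s x)\<^sup>2))
      \<longlongrightarrow> 0) (at t within {0..})" by simp
  have "((\<lambda>s. LINT x|?M. (?W s x)\<^sup>2) \<longlongrightarrow> 0) (at t within {0..})"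
  proof (rule tendsto_sandwich[OF _ _ tendsto_const lim])
    show "\<forall>\<^sub>F s in at t within {0..}. 0 \<le> (LINT x|?M. (?W s x)\<^sup>2)" by simp
    show "\<forall>\<^sub>F s in at t within {0..}. (LINT x|?M. (?W s x)\<^sup>2)
        \<le> 2 * a\<^sup>2 * (LINT x|?M. (?U s x)\<^sup>2) + 2 * b\<^sup>2 * (LINT x|?M. (?V s x)\<^sup>2)"
      using W_le by (auto simp: eventually_at_filter)
  qed
  then show ?thesis
    unfolding L2_time_deriv_def by (auto intro!: L2_add L2_cmult L2)
qed

lemma L2_time_deriv_spatially_constant:
  assumes "(m has_real_derivative m') (at t within {0..})"
  shows "L2_time_deriv (\<lambda>x s. m s) (\<lambda>x. m') t"
proof -
  have "((\<lambda>s. (m s - m t) / (s - t) - m') \<longlongrightarrow> m' - m') (at t within {0..})"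
    using assms unfolding has_field_derivative_iff by (intro tendsto_intros)
  then have "((\<lambda>s. ((m s - m t) / (s - t) - m')\<^sup>2) \<longlongrightarrow> (m' - m')\<^sup>2) (at t within {0..})"
    by (rule tendsto_power)
  then show ?thesis
    by (simp add: L2_time_deriv_def L2_continuous)
qed

text \<open>Nonnegativity of the variance of \<open>\<bar>y\<bar>\<close>; the unit interval has
  total mass 1.\<close>

lemma LINT_abs_le_L2:
  assumes "y \<in> L2"
  shows "(LINT x|unit_lebesgue. \<bar>y x\<bar>) \<le> sqrt (LINT x|unit_lebesgue. (y x)\<^sup>2)"
proof -
  let ?M = unit_lebesgue
  define c where "c = (LINT x|?M. \<bar>y x\<bar>)"
  have i: "integrable ?M (\<lambda>x. (y x)\<^sup>2)" "integrable ?M (\<lambda>x. \<bar>y x\<bar>)" "integrable ?M (\<lambda>x. c\<^sup>2)"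
    using L2_integrable_square[OF assms] L2_imp_integrable[OF assms]
      finite_measure.integrable_const[OF finite_measure_unit] by auto
  have "0 \<le> (LINT x|?M. (\<bar>y x\<bar> - c)\<^sup>2)" by simp
  also have "\<dots> = (LINT x|?M. (y x)\<^sup>2 - 2 * c * \<bar>y x\<bar> + c\<^sup>2)"
    by (simp add: power2_diff algebra_simps)
  also have "\<dots> = (LINT x|?M. (y x)\<^sup>2) - 2 * c * c + c\<^sup>2"
    using i by (simp add: c_def)
  finally have "c\<^sup>2 \<le> (LINT x|?M. (y x)\<^sup>2)" by (simp add: power2_eq_square)
  then show ?thesis unfolding c_def by (rule real_le_rsqrt)
qed

text \<open>A chain rule that needs no pointwise time derivative of \<open>z\<close>. The error of
  the energy quotient splits into a quadratic Taylor remainder, which carries a factor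
  \<open>\<bar>s - t\<bar>\<close>, and a part linear in the L^2 error \<open>?R\<close> of the
  difference quotient.\<close>

lemma bend_energy_deriv:
  assumes z: "L2_time_deriv z zt t" and cont: "\<And>s. s \<ge> 0 \<Longrightarrow> continuous_on {0..1} (\<lambda>x. z x s)"
    and t: "t \<ge> 0"
  shows "((\<lambda>s. LINT x|unit_lebesgue. bend (z x s)) has_real_derivative
    (LINT x|unit_lebesgue. bend' (z x t) * zt x)) (at t within {0..})"
proof -
  let ?M = unit_lebesgue
  let ?E = "\<lambda>s. LINT x|?M. bend (z x s)"
  let ?D = "LINT x|?M. bend' (z x t) * zt x"
  let ?R = "\<lambda>s x. (z x s - z x t) / (s - t) - zt x"
  \<comment> \<open>The first summand bounds the Taylor remainder, with the difference quotient
    written as \<open>?R + zt\<close> before squaring. The second comes from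
    \<open>bend' \<le> 1\<close> and the passage from the L^1 to the L^2 norm of
    \<open>?R\<close>.\<close>
  let ?bound = "\<lambda>s. \<bar>s - t\<bar> * (2 * (LINT x|?M. (?R s x)\<^sup>2) + 2 * (LINT x|?M. (zt x)\<^sup>2))
    + sqrt (LINT x|?M. (?R s x)\<^sup>2)"
  have L2: "\<And>s. s \<ge> 0 \<Longrightarrow> (\<lambda>x. z x s) \<in> L2" "zt \<in> L2"
    and lim: "((\<lambda>s. LINT x|?M. (?R s x)\<^sup>2) \<longlongrightarrow> 0) (at t within {0..})"
    using z by (auto simp: L2_time_deriv_def)
  have RL2: "?R s \<in> L2" if "s \<ge> 0" for s
    using that t by (auto intro!: L2_remainder L2)
  have bend_int: "integrable ?M (\<lambda>x. bend (z x s))" if "s \<ge> 0" for s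
    by (intro unit_integrable_continuous continuous_on_compose2[OF bend_continuous(1) cont[OF that]]) auto
  have bend'_cont: "continuous_on {0..1} (\<lambda>x. bend' (z x t))"
    by (rule continuous_on_compose2[OF bend_continuous(2) cont[OF t]]) auto
  have D_int: "integrable ?M (\<lambda>x. bend' (z x t) * zt x)"
    using unit_integrable_mult_continuous[OF bend'_cont L2_imp_integrable[OF L2(2)]]
    by (simp add: mult.commute)
  have bound: "\<bar>(?E s - ?E t) / (s - t) - ?D\<bar> \<le> ?bound s" if s: "s \<ge> 0" "s \<noteq> t" for s
  proof -
    let ?I = "\<lambda>x. (bend (z x s) - bend (z x t)) / (s - t) - bend' (z x t) * zt x"
    have I_int: "integrable ?M ?I"
      using bend_int[OF s(1)] bend_int[OF t] D_int by auto
    have eq: "(?E s - ?E t) / (s - t) - ?D = (LINT x|?M. ?I x)"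
      using bend_int[OF s(1)] bend_int[OF t] D_int by simp
    have "\<bar>(?E s - ?E t) / (s - t) - ?D\<bar> \<le> (LINT x|?M. \<bar>?I x\<bar>)"
      unfolding eq by (rule integral_abs_bound)
    also have "\<dots> \<le> (LINT x|?M. \<bar>s - t\<bar> * (2 * (?R s x)\<^sup>2 + 2 * (zt x)\<^sup>2) + \<bar>?R s x\<bar>)"
    proof (rule integral_mono)
      show "integrable ?M (\<lambda>x. \<bar>?I x\<bar>)" using I_int by simp
      show "integrable ?M (\<lambda>x. \<bar>s - t\<bar> * (2 * (?R s x)\<^sup>2 + 2 * (zt x)\<^sup>2) + \<bar>?R s x\<bar>)"
        by (intro Bochner_Integration.integrable_add integrable_mult_right integrable_abs
              L2_integrable_square L2_imp_integrable RL2 L2 s)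
      show "\<bar>?I x\<bar> \<le> \<bar>s - t\<bar> * (2 * (?R s x)\<^sup>2 + 2 * (zt x)\<^sup>2) + \<bar>?R s x\<bar>" for x
      proof -
        define Q where "Q = (z x s - z x t) / (s - t)"
        define T where "T = bend (z x s) - bend (z x t) - bend' (z x t) * (z x s - z x t)"
        have Q: "z x s - z x t = Q * (s - t)" using s by (simp add: Q_def)
        have I_eq: "?I x = T / (s - t) + bend' (z x t) * ?R s x"
        proof -
          have "T / (s - t) = (bend (z x s) - bend (z x t)) / (s - t) - bend' (z x t) * Q"
            by (simp add: T_def Q_def diff_divide_distrib[of _ "bend' (z x t) * _"])
          then show ?thesis unfolding Q_def[symmetric] by (simp add: right_diff_distrib)
        qed
        have "\<bar>T\<bar> \<le> Q\<^sup>2 * \<bar>s - t\<bar> * \<bar>s - t\<bar>"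
          using bend_taylor[of "z x s" "z x t"]
          by (simp add: T_def Q power2_eq_square mult_ac)
        then have "\<bar>T / (s - t)\<bar> \<le> \<bar>s - t\<bar> * Q\<^sup>2"
          using s(2) by (simp add: abs_divide divide_le_eq mult_ac)
        also have "\<dots> \<le> \<bar>s - t\<bar> * (2 * (?R s x)\<^sup>2 + 2 * (zt x)\<^sup>2)"
        proof (rule mult_left_mono)
          have "Q\<^sup>2 = (?R s x + zt x)\<^sup>2" by (simp add: Q_def)
          also have "\<dots> \<le> 2 * (?R s x)\<^sup>2 + 2 * (zt x)\<^sup>2"
            using sum_squares_bound[of "?R s x" "zt x"] unfolding power2_sum by linarith
          finally show "Q\<^sup>2 \<le> 2 * (?R s x)\<^sup>2 + 2 * (zt x)\<^sup>2" .
        qed simp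
        finally have 1: "\<bar>T / (s - t)\<bar> \<le> \<bar>s - t\<bar> * (2 * (?R s x)\<^sup>2 + 2 * (zt x)\<^sup>2)" .
        have 2: "\<bar>bend' (z x t) * ?R s x\<bar> \<le> \<bar>?R s x\<bar>"
          using bend'_bounds[of "z x t"] mult_right_mono[of "bend' (z x t)" 1 "\<bar>?R s x\<bar>"]
          by (simp add: abs_mult)
        show ?thesis unfolding I_eq using 1 2 by linarith
      qed
    qed
    also have "\<dots> = \<bar>s - t\<bar> * (2 * (LINT x|?M. (?R s x)\<^sup>2) + 2 * (LINT x|?M. (zt x)\<^sup>2))
        + (LINT x|?M. \<bar>?R s x\<bar>)"
      using L2_integrable_square[OF RL2[OF s(1)]] L2_integrable_square[OF L2(2)]
        L2_imp_integrable[OF RL2[OF s(1)]] by simp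
    also have "\<dots> \<le> ?bound s"
      using LINT_abs_le_L2[OF RL2[OF s(1)]] by simp
    finally show ?thesis .
  qed
  have "(?bound \<longlongrightarrow> \<bar>t - t\<bar> * (2 * 0 + 2 * (LINT x|?M. (zt x)\<^sup>2)) + sqrt 0) (at t within {0..})"
    by (intro tendsto_intros lim)
  then have bound_lim: "(?bound \<longlongrightarrow> 0) (at t within {0..})" by simp
  have "((\<lambda>s. (?E s - ?E t) / (s - t) - ?D) \<longlongrightarrow> 0) (at t within {0..})"
    by (rule Lim_null_comparison[OF _ bound_lim])
       (use bound in \<open>auto simp: eventually_at_filter\<close>)
  then show ?thesis
    unfolding has_field_derivative_iff by (simp add: LIM_zero_iff)
qed

text \<open>Integration by parts gives \<open>h' 1 * bend' (h 1)\<close> minus the integral of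
  \<open>bend'' (h x) * (h' x)^2\<close>. The boundary term at 0 is absent since
  \<open>h' 0 = 0\<close>. At 1 it is zero for nonpositive \<open>h 1\<close> and otherwise has the
  sign of \<open>h' 1\<close>.\<close>

lemma bend'_LINT_second_primitive_nonpos:
  assumes sp: "second_primitive h h' g"
    and left: "h' 0 = 0" and right: "0 < h 1 \<Longrightarrow> h' 1 \<le> 0"
  shows "(LINT x|unit_lebesgue. g x * bend' (h x)) \<le> 0"
proof -
  let ?M = unit_lebesgue
  define p where "p x = bend'' (h x) * h' x" for x
  note hc = second_primitive_continuous[OF sp]
  have g: "integrable ?M g"
    by (rule L2_imp_integrable[OF second_primitiveD(1)[OF sp]])
  have p_cont: "continuous_on {0..1} p"
    unfolding p_def by (intro continuous_on_mult hc continuous_on_compose2[OF bend_continuous(3)[of UNIV] hc(1)]) simp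
  have p: "integrable ?M p" by (rule unit_integrable_continuous[OF p_cont])
  have h'_eq: "integral {0..x} g = h' x" if "x \<in> {0..1}" for x
    using second_primitiveD(3)[OF sp that] left by simp
  have p_eq: "integral {0..x} p = bend' (h x) - bend' (h 0)" if "x \<in> {0..1}" for x
  proof (rule integral_unique, rule fundamental_theorem_of_calculus)
    show "((\<lambda>y. bend' (h y)) has_vector_derivative p y) (at y within {0..x})" if "y \<in> {0..x}" for y
    proof -
      have "y \<in> {0..1}" using that \<open>x \<in> {0..1}\<close> by auto
      then have "((\<lambda>y. bend' (h y)) has_real_derivative p y) (at y within {0..1})"
        unfolding p_def by (intro DERIV_chain2[OF DERIV_bend'] second_primitiveD(2)[OF sp])
      then have "((\<lambda>y. bend' (h y)) has_real_derivative p y) (at y within {0..x})"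
        by (rule DERIV_subset) (use \<open>x \<in> {0..1}\<close> in auto)
      then show ?thesis
        by (simp add: has_real_derivative_iff_has_vector_derivative)
    qed
  qed (use that in auto)
  have i1: "integrable ?M (\<lambda>x. g x * integral {0..x} p)"
    by (rule unit_integrable_mult_continuous[OF unit_primitive_continuous[OF p] g])
  \<comment> \<open>Integration by parts is available for primitives that vanish at 0, so the
    constant \<open>bend' (h 0)\<close> is split off first.\<close>
  have "(LINT x|?M. g x * bend' (h x)) = (LINT x|?M. bend' (h 0) * g x + g x * integral {0..x} p)"
    by (rule Bochner_Integration.integral_cong) (auto simp: p_eq algebra_simps)
  also have "\<dots> = bend' (h 0) * integral {0..1} g + (LINT x|?M. g x * integral {0..x} p)"
    using g i1 unit_LINT[OF g] by simp
  also have "\<dots> = h' 1 * bend' (h 1) - (LINT x|?M. p x * integral {0..x} g)"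
    unfolding unit_integral_by_parts[OF g p] by (simp add: h'_eq p_eq algebra_simps)
  also have "(LINT x|?M. p x * integral {0..x} g) = (LINT x|?M. bend'' (h x) * (h' x)\<^sup>2)"
    by (rule Bochner_Integration.integral_cong) (auto simp: h'_eq p_def power2_eq_square)
  finally have "(LINT x|?M. g x * bend' (h x)) = h' 1 * bend' (h 1) - (LINT x|?M. bend'' (h x) * (h' x)\<^sup>2)" .
  moreover have "0 \<le> (LINT x|?M. bend'' (h x) * (h' x)\<^sup>2)"
    by (intro integral_nonneg_AE AE_I2 mult_nonneg_nonneg bend''_bounds) simp
  moreover have "h' 1 * bend' (h 1) \<le> 0"
    using right bend'_bounds[of "h 1"] bend'_nonpos[of "h 1"]
    by (cases "0 < h 1") (auto intro: mult_nonpos_nonneg)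
  ultimately show ?thesis by linarith
qed

text \<open>Multiplying the differential inequality by \<open>bend' \<ge> 0\<close> preserves it,
  and the diffusion term is handled by \<open>bend'_LINT_second_primitive_nonpos\<close>. A zero
  energy forces the continuous nonnegative \<open>bend\<close> to vanish on all of
  \<open>{0..1}\<close>, so the conclusion includes the end points.\<close>

lemma parabolic_max_principle:
  fixes z zt :: "real \<Rightarrow> real \<Rightarrow> real" and \<alpha> lam T :: real
  assumes "\<alpha> \<ge> 0" "lam \<ge> 0" "T > 0"
    and deriv: "\<And>t. t \<ge> 0 \<Longrightarrow> L2_time_deriv z (zt t) t"
    and cont: "\<And>t. t \<ge> 0 \<Longrightarrow> continuous_on {0..1} (\<lambda>x. z x t)"
    and space: "\<And>t. 0 < t \<Longrightarrow> t < T \<Longrightarrow> second_primitive (\<lambda>x. z x t) (zx t) (zxx t)"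
    and pde: "\<And>t. 0 < t \<Longrightarrow> t < T \<Longrightarrow>
      AE x in unit_lebesgue. zt t x \<le> \<alpha> * zxx t x - lam * z x t"
    and left: "\<And>t. 0 < t \<Longrightarrow> t < T \<Longrightarrow> zx t 0 = 0"
    and right: "\<And>t. 0 < t \<Longrightarrow> t < T \<Longrightarrow> 0 < z 1 t \<Longrightarrow> zx t 1 \<le> 0"
    and init: "\<And>x. x \<in> {0<..<1} \<Longrightarrow> z x 0 \<le> 0"
    and x: "x \<in> {0..1}"
  shows "z x T \<le> 0"
proof -
  let ?M = unit_lebesgue
  define E where "E t = (LINT x|?M. bend (z x t))" for t
  have bend_cont: "continuous_on {0..1} (\<lambda>x. bend (z x t))" "continuous_on {0..1} (\<lambda>x. bend' (z x t))"
    if "t \<ge> 0" for t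
    by (rule continuous_on_compose2[OF bend_continuous(1)[of UNIV] cont[OF that]]
      continuous_on_compose2[OF bend_continuous(2)[of UNIV] cont[OF that]], simp)+
  have E_deriv: "(E has_real_derivative (LINT x|?M. bend' (z x t) * zt t x)) (at t within {0..})"
    if "t \<ge> 0" for t
    unfolding E_def[abs_def] by (rule bend_energy_deriv[OF deriv[OF that] cont that])
  have decay: "(LINT x|?M. bend' (z x t) * zt t x) \<le> 0" if t: "0 < t" "t < T" for t
  proof -
    have L2: "zt t \<in> L2" "zxx t \<in> L2"
      using deriv[of t] second_primitiveD(1)[OF space[OF t]] t by (auto simp: L2_time_deriv_def)
    note bc = bend_cont(2)[OF less_imp_le[OF t(1)]]
    have i: "integrable ?M (\<lambda>x. zxx t x * bend' (z x t))"
      by (rule unit_integrable_mult_continuous[OF bc L2_imp_integrable[OF L2(2)]])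
    have "(LINT x|?M. bend' (z x t) * zt t x) \<le> (LINT x|?M. \<alpha> * (zxx t x * bend' (z x t)))"
    proof (rule integral_mono_AE)
      show "integrable ?M (\<lambda>x. bend' (z x t) * zt t x)"
        using unit_integrable_mult_continuous[OF bc L2_imp_integrable[OF L2(1)]] by (simp add: mult.commute)
      show "integrable ?M (\<lambda>x. \<alpha> * (zxx t x * bend' (z x t)))" using i by simp
      show "AE x in ?M. bend' (z x t) * zt t x \<le> \<alpha> * (zxx t x * bend' (z x t))"
        using pde[OF t]
      proof eventually_elim
        case (elim x)
        \<comment> \<open>Where \<open>z\<close> is nonpositive the weight is zero, elsewhere both
          factors are nonnegative; the damping term can therefore be discarded.\<close>
        have "0 \<le> bend' (z x t) * (lam * z x t)"
          using \<open>lam \<ge> 0\<close> bend'_bounds[of "z x t"] bend'_nonpos[of "z x t"]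
          by (cases "0 < z x t") auto
        moreover have "bend' (z x t) * zt t x \<le> bend' (z x t) * (\<alpha> * zxx t x - lam * z x t)"
          using elim bend'_bounds(1) by (rule mult_left_mono)
        ultimately show ?case by (simp add: algebra_simps)
      qed
    qed
    also have "\<dots> = \<alpha> * (LINT x|?M. zxx t x * bend' (z x t))" by simp
    also have "\<dots> \<le> 0"
      by (intro mult_nonneg_nonpos \<open>\<alpha> \<ge> 0\<close>
            bend'_LINT_second_primitive_nonpos[OF space[OF t] left[OF t] right[OF t]])
    finally show ?thesis .
  qed
  \<comment> \<open>The sign of the derivative is known only for \<open>0 < t < T\<close>; at the
    two ends continuity of the energy is enough.\<close>
  have "E T \<le> E 0"
  proof (rule DERIV_nonpos_imp_decreasing_open[OF less_imp_le[OF \<open>T > 0\<close>]])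
    fix t assume t: "0 < t" "t < T"
    have "at t within {0..} = at t"
      by (rule at_within_interior) (use t in simp)
    then show "\<exists>y. (E has_real_derivative y) (at t) \<and> y \<le> 0"
      using E_deriv[of t] decay[OF t] t by auto
  next
    show "continuous_on {0..T} E"
    proof (rule DERIV_continuous_on)
      show "(E has_real_derivative (LINT x|?M. bend' (z x t) * zt t x)) (at t within {0..T})"
        if "t \<in> {0..T}" for t
        by (rule DERIV_subset[OF E_deriv]) (use that in auto)
    qed
  qed
  moreover have "E 0 = 0"
    unfolding E_def by (rule integral_eq_zero_AE) (use init bend_nonpos in \<open>auto intro!: AE_I2\<close>)
  moreover have "0 \<le> E T"
    unfolding E_def by (intro integral_nonneg_AE AE_I2 bend_nonneg)
  ultimately have "E T = 0" by simp
  note bcT = bend_cont(1)[OF less_imp_le[OF \<open>T > 0\<close>]]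
  have "integral {0..1} (\<lambda>x. bend (z x T)) = 0"
    using \<open>E T = 0\<close> unit_LINT[OF unit_integrable_continuous[OF bcT]] by (simp add: E_def)
  then have "bend (z x T) = 0"
    using integral_eq_0_iff[of 0 1 "\<lambda>x. bend (z x T)"] bcT x bend_nonneg by auto
  then show ?thesis using bend_pos[of "z x T"] by linarith
qed

section \<open>The error system\<close>

text \<open>The comparison function solves \<open>m' = B - lam * m\<close>, with equilibrium
  \<open>B / lam\<close> and \<open>m 0 = A + B / lam\<close>. It therefore absorbs both the source
  and the initial values when subtracted from \<open>w\<close> or from \<open>- w\<close>.\<close>

lemma heat_sup_estimate:
  fixes w wt wx wxx f :: "real \<Rightarrow> real \<Rightarrow> real" and \<alpha> lam l T A B :: real
  assumes const: "\<alpha> \<ge> 0" "lam > 0" "l \<ge> 0" "T > 0" "A \<ge> 0" "B \<ge> 0"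
    and deriv: "\<And>t. t \<ge> 0 \<Longrightarrow> L2_time_deriv w (wt t) t"
    and cont: "\<And>t. t \<ge> 0 \<Longrightarrow> continuous_on {0..1} (\<lambda>x. w x t)"
    and space: "\<And>t. 0 < t \<Longrightarrow> second_primitive (\<lambda>x. w x t) (wx t) (wxx t)"
    and pde: "\<And>t. 0 < t \<Longrightarrow> AE x in unit_lebesgue. wt t x = \<alpha> * wxx t x - lam * w x t + f x t"
    and left: "\<And>t. 0 < t \<Longrightarrow> wx t 0 = 0"
    and right: "\<And>t. 0 < t \<Longrightarrow> wx t 1 = - l * w 1 t"
    and f: "\<And>x t. x \<in> {0<..<1} \<Longrightarrow> 0 < t \<Longrightarrow> t < T \<Longrightarrow> \<bar>f x t\<bar> \<le> B"
    and init: "\<And>x. x \<in> {0<..<1} \<Longrightarrow> \<bar>w x 0\<bar> \<le> A"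
    and x: "x \<in> {0..1}"
  shows "\<bar>w x T\<bar> \<le> exp (- lam * T) * A + B / lam"
proof -
  define m where "m t = exp (- lam * t) * A + B / lam" for t
  define m' where "m' t = - lam * exp (- lam * t) * A" for t
  have m_ode: "m' t = B - lam * m t" for t
    using \<open>lam > 0\<close> by (simp add: m_def m'_def algebra_simps)
  have m_nonneg: "0 \<le> m t" for t
    using const by (simp add: m_def)
  have m_deriv: "(m has_real_derivative m' t) (at t within S)" for t S
    unfolding m_def[abs_def] m'_def by (auto intro!: derivative_eq_intros)
  \<comment> \<open>The values 1 and -1 of \<open>c\<close> give the upper and the lower bound for
    \<open>w\<close>.\<close>
  have upper: "c * w x T \<le> m T" if c: "\<bar>c\<bar> = 1" for c :: real
  proof -
    define z where "z x t = c * w x t + (-1) * m t" for x t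
    have z1: "c * w y t = z y t + m t" for y t by (simp add: z_def)
    have "z x T \<le> 0"
    \<comment> \<open>\<open>m\<close> is constant in space and enters only through its time
      derivative; the summands \<open>0 * 0\<close> stand for its vanishing spatial
      derivatives.\<close>
    proof (rule parabolic_max_principle[where z=z and T=T and x=x and zt="\<lambda>t x. c * wt t x + (-1) * m' t"
          and zx="\<lambda>t x. c * wx t x + 0 * 0" and zxx="\<lambda>t x. c * wxx t x + 0 * 0" and \<alpha>=\<alpha> and lam=lam])
      fix t :: real
      assume t: "t \<ge> 0"
      show "L2_time_deriv z (\<lambda>x. c * wt t x + (-1) * m' t) t"
        unfolding z_def[abs_def]
        by (rule L2_time_deriv_linear[OF deriv[OF t] L2_time_deriv_spatially_constant[OF m_deriv] t])
      show "continuous_on {0..1} (\<lambda>x. z x t)"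
        unfolding z_def by (intro continuous_intros cont t)
    next
      fix t :: real
      assume t: "0 < t" "t < T"
      have "second_primitive (\<lambda>x. 1) (\<lambda>x. 0) (\<lambda>x. 0)"
        by (auto simp: second_primitive_def intro!: L2_continuous)
      from second_primitive_linear[OF space[OF t(1)] this, of c "- m t"]
      show "second_primitive (\<lambda>x. z x t) (\<lambda>x. c * wx t x + 0 * 0) (\<lambda>x. c * wxx t x + 0 * 0)"
        by (simp add: z_def)
      show "c * wx t 0 + 0 * 0 = 0" using left[OF t(1)] by simp
      show "c * wx t 1 + 0 * 0 \<le> 0" if "0 < z 1 t"
      proof -
        \<comment> \<open>Positivity of \<open>z\<close> at \<open>x = 1\<close> means that
          \<open>c * w 1 t\<close> exceeds \<open>m t \<ge> 0\<close>, so the Robin condition yields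
          the required sign of the flux.\<close>
        have "0 \<le> l * (c * w 1 t)"
          unfolding z1 using that m_nonneg[of t] const by simp
        then show ?thesis using right[OF t(1)] by (simp add: mult_ac)
      qed
      show "AE x in unit_lebesgue. c * wt t x + (-1) * m' t
          \<le> \<alpha> * (c * wxx t x + 0 * 0) - lam * z x t"
        using pde[OF t(1)] AE_space
      proof eventually_elim
        case (elim x)
        have "c * f x t \<le> B"
          using f[of x t] elim(2) t c abs_ge_self[of "c * f x t"] by (simp add: abs_mult)
        then show ?case
          unfolding elim(1) m_ode z_def by (simp add: algebra_simps)
      qed
    next
      fix x :: real assume x: "x \<in> {0<..<1}"
      have "c * w x 0 \<le> A"
        using init[OF x] c abs_ge_self[of "c * w x 0"] by (simp add: abs_mult)
      moreover have "0 \<le> B / lam" using const by simp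
      ultimately show "z x 0 \<le> 0" by (simp add: z_def m_def)
    qed (use const x in auto)
    then show ?thesis by (simp add: z_def)
  qed
  show ?thesis
    using upper[of 1] upper[of "-1"] by (simp add: m_def abs_le_iff)
qed

text \<open>Boundary conditions state derivatives as relations. Uniqueness of one-sided limits
  identifies their values with the representative \<open>wx\<close> at the end points.\<close>

lemma x_deriv_unique_at_ends:
  assumes "x_deriv h x D" "x_deriv h x E" "x = 0 \<or> x = 1"
  shows "D = E"
proof -
  have "at x within {0..1} \<noteq> bot"
    using assms(3) by (auto simp: at_within_Icc_at_left at_within_Icc_at_right)
  then show ?thesis
    using tendsto_unique assms(1,2) unfolding has_field_derivative_iff by blast
qed

lemma C_norm_upper:
  assumes "bdd_above ((\<lambda>z. \<bar>h z\<bar>) ` K)" "z \<in> K"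
  shows "\<bar>h z\<bar> \<le> C_norm K h"
  unfolding C_norm_def by (rule cSUP_upper[OF assms(2,1)])

lemma C_norm_least:
  assumes "K \<noteq> {}" "\<And>z. z \<in> K \<Longrightarrow> \<bar>h z\<bar> \<le> b"
  shows "C_norm K h \<le> b"
  unfolding C_norm_def by (rule cSUP_least[OF assms])

lemma bdd_above_abs_continuous:
  fixes h :: "'a::topological_space \<Rightarrow> real"
  assumes "compact K" "continuous_on K h"
  shows "bdd_above ((\<lambda>z. \<bar>h z\<bar>) ` K)"
  by (intro bounded_imp_bdd_above compact_imp_bounded compact_continuous_image continuous_intros assms)

lemma classical_solutionD:
  assumes "classical_solution \<alpha> lam f u"
  obtains ut ux where
    "\<And>t. t \<ge> 0 \<Longrightarrow> L2_time_deriv u (ut t) t"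
    "\<And>t. t \<ge> 0 \<Longrightarrow> second_primitive (\<lambda>x. u x t) (ux t) (wderiv (wderiv (\<lambda>x. u x t)))"
    "\<And>t. t > 0 \<Longrightarrow> AE x in unit_lebesgue.
       ut t x = \<alpha> * wderiv (wderiv (\<lambda>y. u y t)) x - lam * u x t + f x t"
proof -
  obtain ut where ut: "C1_time_L2 u ut"
      "\<And>t. t > 0 \<Longrightarrow> AE x in unit_lebesgue.
         ut x t = \<alpha> * wderiv (wderiv (\<lambda>y. u y t)) x - lam * u x t + f x t"
    using assms unfolding classical_solution_def by blast
  have "\<exists>h'. second_primitive (\<lambda>x. u x t) h' (wderiv (wderiv (\<lambda>x. u x t)))" if "t \<ge> 0" for t
    using assms that H2_second_primitive unfolding classical_solution_def cont_time_H2_def by metis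
  then obtain ux where "\<And>t. t \<ge> 0 \<Longrightarrow>
      second_primitive (\<lambda>x. u x t) (ux t) (wderiv (wderiv (\<lambda>x. u x t)))"
    by metis
  with ut show thesis
    by (intro that[of "\<lambda>t x. ut x t" ux]) (auto intro: C1_time_L2_imp_deriv)
qed

theorem theorem3p1:
  fixes N :: nat
    and \<alpha> lam l :: real
    and k :: "nat \<Rightarrow> real"
    and f :: "nat \<Rightarrow> real \<Rightarrow> real \<Rightarrow> real"
    and d0 d1 q :: "nat \<Rightarrow> real \<Rightarrow> real"
    and r :: "real \<Rightarrow> real"
    and u v qh :: "nat \<Rightarrow> real \<Rightarrow> real \<Rightarrow> real"
    and uref :: "real \<Rightarrow> real \<Rightarrow> real"
    and u0 v0 qh0 :: "nat \<Rightarrow> real \<Rightarrow> real"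
    and uref0 :: "real \<Rightarrow> real"
  assumes N: "N \<ge> 2"
    and constants: "\<alpha> > 0" "lam > 0" "l > 0"
    and gains: "\<And>i. i \<in> {1..N} \<Longrightarrow> 0 < k i \<and> k i < l"
    and f_cont: "\<And>i. i \<in> {1..N} \<Longrightarrow> continuous_on ({0..1} \<times> {0..}) (\<lambda>(x, t). f i x t)"
    and C1_data: "\<And>i. i \<in> {1..N} \<Longrightarrow> C1_halfline (d0 i) \<and> C1_halfline (d1 i) \<and> C1_halfline (q i)"
    and C1_r: "C1_halfline r"
    and init_u: "\<And>i. i \<in> {1..N} \<Longrightarrow>
      (\<lambda>x. u0 i x - uref0 x) \<in> H2 \<and> continuous_on {0..1} (\<lambda>x. u0 i x - uref0 x)"
    and init_uref: "uref0 \<in> H2" "continuous_on {0..1} uref0"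
    and init_v: "\<And>i. i \<in> {1..N} \<Longrightarrow> v0 i \<in> H2 \<and> continuous_on {0..1} (v0 i)"
    and compat_u_0: "\<And>i. i \<in> {1..N} \<Longrightarrow> u0 i 0 - uref0 0 = q i 0 + d0 i 0 - qh0 i 0"
    and compat_u_1: "\<And>i. i \<in> {1..N} \<Longrightarrow>
      x_deriv (\<lambda>x. u0 i x - uref0 x) 1
        (- l * (u0 i 1 - uref0 1) + k i * (u0 (pred_agent N i) 1 - uref0 1) + d1 i 0)"
    and compat_uref: "uref0 0 = r 0" "x_deriv uref0 1 (- l * uref0 1)"
    and compat_v: "\<And>i. i \<in> {1..N} \<Longrightarrow> v0 i 0 = U0 r qh d0 i 0 \<and>
      x_deriv (v0 i) 1 (- l * v0 i 1 + U1 N k u uref d1 i 0)"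
    and agents: "\<And>i. i \<in> {1..N} \<Longrightarrow>
      agent_system \<alpha> lam l (f i) (q i) (U0 r qh d0 i) (U1 N k u uref d1 i) (u0 i) (u i)"
    and reference: "reference_system \<alpha> lam l r uref0 uref"
    and auxiliary: "\<And>i. i \<in> {1..N} \<Longrightarrow>
      auxiliary_system \<alpha> lam l (U0 r qh d0 i) (U1 N k u uref d1 i) (v0 i) (v i)"
    and observer: "\<And>i. i \<in> {1..N} \<Longrightarrow>
      disturbance_observer \<alpha> lam l (u i) (v i) (qh0 i) (qh i)"
  shows "\<forall>i\<in>{1..N}. \<forall>\<sigma>\<in>{0<..<lam}. \<forall>t>0.
    \<bar>q i t - qh i 0 t\<bar> \<le> C_norm {0..1} (\<lambda>x. u i x t - v i x t - qh i x t) \<and>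
    C_norm {0..1} (\<lambda>x. u i x t - v i x t - qh i x t)
      \<le> exp (- \<sigma> * t) * C_norm {0..1} (\<lambda>x. u0 i x - v0 i x - qh0 i x)
        + 1 / (lam - \<sigma>) * C_norm ({0..1} \<times> {0..t}) (\<lambda>(x, s). f i x s)"
proof (intro ballI allI impI)
  fix i \<sigma> T assume i: "i \<in> {1..N}" and \<sigma>: "\<sigma> \<in> {0<..<lam}" and T: "(T::real) > 0"
  note ag = agents[OF i, unfolded agent_system_def]
    and au = auxiliary[OF i, unfolded auxiliary_system_def]
    and ob = observer[OF i, unfolded disturbance_observer_def]
  obtain ut ux where u:
      "\<And>t. t \<ge> 0 \<Longrightarrow> L2_time_deriv (u i) (ut t) t"
      "\<And>t. t \<ge> 0 \<Longrightarrow> second_primitive (\<lambda>x. u i x t) (ux t) (wderiv (wderiv (\<lambda>x. u i x t)))"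
      "\<And>t. t > 0 \<Longrightarrow> AE x in unit_lebesgue.
         ut t x = \<alpha> * wderiv (wderiv (\<lambda>y. u i y t)) x - lam * u i x t + f i x t"
    using ag classical_solutionD[of \<alpha> lam "f i" "u i"] by blast
  obtain vt vx where v:
      "\<And>t. t \<ge> 0 \<Longrightarrow> L2_time_deriv (v i) (vt t) t"
      "\<And>t. t \<ge> 0 \<Longrightarrow> second_primitive (\<lambda>x. v i x t) (vx t) (wderiv (wderiv (\<lambda>x. v i x t)))"
      "\<And>t. t > 0 \<Longrightarrow> AE x in unit_lebesgue.
         vt t x = \<alpha> * wderiv (wderiv (\<lambda>y. v i y t)) x - lam * v i x t + 0"
    using au classical_solutionD[of \<alpha> lam "\<lambda>x t. 0" "v i"] by blast
  obtain qt qx where q: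
      "\<And>t. t \<ge> 0 \<Longrightarrow> L2_time_deriv (qh i) (qt t) t"
      "\<And>t. t \<ge> 0 \<Longrightarrow> second_primitive (\<lambda>x. qh i x t) (qx t) (wderiv (wderiv (\<lambda>x. qh i x t)))"
      "\<And>t. t > 0 \<Longrightarrow> AE x in unit_lebesgue.
         qt t x = \<alpha> * wderiv (wderiv (\<lambda>y. qh i y t)) x - lam * qh i x t + 0"
    using ob classical_solutionD[of \<alpha> lam "\<lambda>x t. 0" "qh i"] by blast
  define w where "w x t = u i x t - v i x t - qh i x t" for x t
  define wt where "wt t x = ut t x - vt t x - qt t x" for t x
  define wx where "wx t x = ux t x - vx t x - qx t x" for t x
  \<comment> \<open>A combination of the three chosen representatives, not
    \<open>wderiv (wderiv w)\<close>, so that the almost everywhere equations can be subtracted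
    directly.\<close>
  define wxx where "wxx t x = wderiv (wderiv (\<lambda>x. u i x t)) x
    - wderiv (wderiv (\<lambda>x. v i x t)) x - wderiv (wderiv (\<lambda>x. qh i x t)) x" for t x
  have sp: "second_primitive (\<lambda>x. w x t) (wx t) (wxx t)" if "t \<ge> 0" for t
    using second_primitive_linear[OF second_primitive_linear[OF u(2)[OF that] v(2)[OF that], of 1 "-1"]
        q(2)[OF that], of 1 "-1"]
    by (simp add: w_def wx_def[abs_def] wxx_def[abs_def])
  note cont = second_primitive_continuous(1)[OF sp]
  define h0 where "h0 x = u0 i x - v0 i x - qh0 i x" for x
  have w0: "w x 0 = h0 x" if "x \<in> {0<..<1}" for x
    using ag au ob that by (simp add: w_def h0_def)
  define A where "A = C_norm {0..1} h0"
  define B where "B = C_norm ({0..1} \<times> {0..T}) (\<lambda>(x, s). f i x s)"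
  \<comment> \<open>The initial conditions link \<open>h0\<close> to \<open>w\<close> at time 0 only
    inside the interval. Boundedness follows by adding the two end-point values of \<open>h0\<close>
    to the bounded range of the continuous \<open>w\<close>.\<close>
  have "bdd_above ((\<lambda>x. \<bar>h0 x\<bar>) ` {0..1})"
  proof -
    have "(\<lambda>x. \<bar>h0 x\<bar>) ` {0..1} \<subseteq> insert \<bar>h0 0\<bar> (insert \<bar>h0 1\<bar> ((\<lambda>x. \<bar>w x 0\<bar>) ` {0..1}))"
    proof (rule image_subsetI)
      fix x :: real assume "x \<in> {0..1}"
      then consider "x = 0" | "x = 1" | "x \<in> {0<..<1}" by fastforce
      then show "\<bar>h0 x\<bar> \<in> insert \<bar>h0 0\<bar> (insert \<bar>h0 1\<bar> ((\<lambda>x. \<bar>w x 0\<bar>) ` {0..1}))"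
        by cases (auto simp flip: w0)
    qed
    moreover have "bdd_above (insert \<bar>h0 0\<bar> (insert \<bar>h0 1\<bar> ((\<lambda>x. \<bar>w x 0\<bar>) ` {0..1})))"
      using bdd_above_abs_continuous[OF compact_Icc cont[of 0]] by simp
    ultimately show ?thesis by (rule bdd_above_mono[rotated])
  qed
  then have A: "\<bar>h0 x\<bar> \<le> A" if "x \<in> {0..1}" for x
    unfolding A_def using that by (rule C_norm_upper)
  have "bdd_above ((\<lambda>z. \<bar>(\<lambda>(x, s). f i x s) z\<bar>) ` ({0..1} \<times> {0..T}))"
    by (intro bdd_above_abs_continuous compact_Times compact_Icc continuous_on_subset[OF f_cont[OF i]]) auto
  then have B: "\<bar>f i x s\<bar> \<le> B" if "x \<in> {0..1}" "s \<in> {0..T}" for x s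
    using C_norm_upper[of "\<lambda>(x, s). f i x s" "{0..1} \<times> {0..T}" "(x, s)"] that by (simp add: B_def)
  have AB: "0 \<le> A" "0 \<le> B"
    using A[of 0] B[of 0 0] T by (auto intro: order_trans[OF abs_ge_zero])
  have bound: "\<bar>w x T\<bar> \<le> exp (- lam * T) * A + B / lam" if x: "x \<in> {0..1}" for x
  proof (rule heat_sup_estimate[where w=w and T=T and x=x and wt=wt and wx=wx and wxx=wxx and f="f i" and \<alpha>=\<alpha> and l=l])
    fix t :: real
    assume t: "t \<ge> 0"
    show "L2_time_deriv w (wt t) t"
      using L2_time_deriv_linear[OF L2_time_deriv_linear[OF u(1)[OF t] v(1)[OF t] t, of 1 "-1"]
          q(1)[OF t] t, of 1 "-1"]
      by (simp add: w_def[abs_def] wt_def[abs_def])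
    show "continuous_on {0..1} (\<lambda>x. w x t)" by (rule cont[OF t])
  next
    fix t :: real
    assume t: "0 < t"
    show sp_t: "second_primitive (\<lambda>x. w x t) (wx t) (wxx t)" using t by (intro sp) simp
    show "AE x in unit_lebesgue. wt t x = \<alpha> * wxx t x - lam * w x t + f i x t"
      using u(3)[OF t] v(3)[OF t] q(3)[OF t]
      by eventually_elim (simp add: wt_def wxx_def w_def algebra_simps)
    \<comment> \<open>The observer's flux at 0 is by design the difference of the fluxes of
      \<open>u\<close> and \<open>v\<close>, so the flux of \<open>w\<close> cancels.\<close>
    obtain a b where "x_deriv (\<lambda>x. u i x t) 0 a" "x_deriv (\<lambda>x. v i x t) 0 b" "x_deriv (\<lambda>x. qh i x t) 0 (a - b)"
      using ob t by blast
    then have "x_deriv (\<lambda>x. w x t) 0 (a - b - (a - b))"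
      unfolding w_def by (intro DERIV_diff)
    then show "wx t 0 = 0"
      using x_deriv_unique_at_ends[OF second_primitiveD(2)[OF sp_t, of 0]] by simp
    \<comment> \<open>The control \<open>U1\<close> acts identically on agent and auxiliary system
      and cancels, leaving a homogeneous Robin condition.\<close>
    have "x_deriv (\<lambda>x. w x t) 1 ((- l * u i 1 t + U1 N k u uref d1 i t)
        - (- l * v i 1 t + U1 N k u uref d1 i t) - (- l * qh i 1 t))"
      unfolding w_def using ag au ob t by (intro DERIV_diff) blast+
    then show "wx t 1 = - l * w 1 t"
      using x_deriv_unique_at_ends[OF second_primitiveD(2)[OF sp_t, of 1]]
      by (simp add: w_def algebra_simps)
  qed (use constants T AB A B x w0 in auto)
  \<comment> \<open>The bound with rate \<open>lam\<close> is stronger than the claim: for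
    \<open>0 < \<sigma> < lam\<close> and nonnegative \<open>A\<close>, \<open>B\<close>, both terms
    can only grow when \<open>\<sigma>\<close> is brought in.\<close>
  have "B / lam \<le> 1 / (lam - \<sigma>) * B"
    using \<sigma> AB constants by (simp add: frac_le)
  moreover have "exp (- lam * T) * A \<le> exp (- \<sigma> * T) * A"
    using \<sigma> AB T by (intro mult_right_mono) auto
  ultimately have bound': "\<bar>w x T\<bar> \<le> exp (- \<sigma> * T) * A + 1 / (lam - \<sigma>) * B" if "x \<in> {0..1}" for x
    using bound[OF that] by linarith
  have "\<bar>w 0 T\<bar> \<le> C_norm {0..1} (\<lambda>x. w x T)"
    by (rule C_norm_upper[OF bdd_above_abs_continuous[OF compact_Icc cont]]) (use T in auto)
  \<comment> \<open>At \<open>x = 0\<close> the control \<open>U0\<close> cancels between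
    \<open>u\<close> and \<open>v\<close>, and the disturbance remains.\<close>
  moreover have "w 0 T = q i T - qh i 0 T"
    using ag au T by (simp add: w_def)
  moreover have "C_norm {0..1} (\<lambda>x. w x T) \<le> exp (- \<sigma> * T) * A + 1 / (lam - \<sigma>) * B"
    by (rule C_norm_least) (use bound' in auto)
  ultimately show "\<bar>q i T - qh i 0 T\<bar> \<le> C_norm {0..1} (\<lambda>x. u i x T - v i x T - qh i x T) \<and>
    C_norm {0..1} (\<lambda>x. u i x T - v i x T - qh i x T)
      \<le> exp (- \<sigma> * T) * C_norm {0..1} (\<lambda>x. u0 i x - v0 i x - qh0 i x)
        + 1 / (lam - \<sigma>) * C_norm ({0..1} \<times> {0..T}) (\<lambda>(x, s). f i x s)"
    by (simp add: w_def A_def B_def h0_def[abs_def])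
qed

end
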